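(* Let $A$ be a (nonempty) bounded subset of $\mathbb{R}^N$, $N\ge1$, let $0\le D<N$ and $\alpha>0$, and let $\zeta_A$ be the distance zeta function of $A$ (for any fixed $\delta>0$). (1) (Minkowski measurable case.) Suppose there is $\mathcal M\in(0,+\infty)$ such that $|A_t|=t^{N-D}(\mathcal M+O(t^\alpha))$ as $t\to0^+$. Then $\dim_BA=D$, $A$ is Minkowski measurable with $\mathcal M^D(A)=\mathcal M$, $D(\zeta_A)=D$, and $\zeta_A$ has a unique meromorphic continuation to (at least) $\{\operatorname{Re}s>D-\alpha\}$ (that is, $D_{\rm mer}(\zeta_A)\le D-\alpha$). The only pole of $\zeta_A$ in this half-plane is $s=D$; it is simple, and $$\operatorname{res}(\zeta_A,D)=(N-D)\mathcal M^D(A).$$ (2) (Minkowski nonmeasurable case.) Suppose there is a nonconstant periodic function $G:\mathbb{R}\to[0,+\infty)$ with minimal period $T>0$ such that $|A_t|=t^{N-D}(G(\log t^{-1})+O(t^\alpha))$ as $t\to0^+$. Then $\dim_BA=D$, $G$ is continuous, $A$ is Minkowski nondegenerate with $\mathcal M_*^D(A)=\min G$ and $\mathcal M^{*D}(A)=\max G$, $A$ is not Minkowski measurable, $D(\zeta_A)=D$, and $\zeta_A$ has a unique meromorphic continuation to (at least) $\{\operatorname{Re}s>D-\alpha\}$ (that is, $D_{\rm mer}(\zeta_A)\le D-\alpha$). The set of all poles of $\zeta_A$ in this half-plane is $$\mathcal P(\zeta_A)=\left\{s_k=D+\frac{2\pi}{T}ik:\ \hat G_0\Big(\frac kT\Big)\ne0,\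 k\in\mathbb{Z}\right\};$$ it coincides with the set $\dim_{PC}A$ of principal complex dimensions of $A$, it contains $s_0=D$, it contains $s_{-k}$ whenever it contains $s_k$, and all these poles are simple. For each pole $s_k$, $$\operatorname{res}(\zeta_A,s_k)=\frac{N-s_k}{T}\,\hat G_0\Big(\frac kT\Big),$$ and $|\operatorname{res}(\zeta_A,s_k)|=o(|k|)$ as $k\to\pm\infty$. Moreover, $$\operatorname{res}(\zeta_A,D)=(N-D)\frac1T\int_0^TG(\tau)\,d\tau$$ and $$(N-D)\mathcal M_*^D(A)<\operatorname{res}(\zeta_A,D)<(N-D)\mathcal M^{*D}(A).$$
   Context: For $A\subset\mathbb{R}^N$ nonempty and bounded, $d(x,A)$ is the Euclidean distance from $x$ to $A$, $A_t:=\{x\in\mathbb{R}^N: d(x,A)<t\}$, and $|A_t|$ is its $N$-dimensional Lebesgue measure. For $r\ge0$, $\mathcal M^{*r}(A)=\limsup_{t\to0^+}|A_t|/t^{N-r}$ and $\mathcal M_*^{r}(A)=\liminf_{t\to0^+}|A_t|/t^{N-r}$. The upper (resp. lower) Minkowski dimension of $A$ is $\inf\{r>0:\mathcal M^{*r}(A)=0\}$ (resp. the same with $\mathcal M_*^r$); if they coincide, the common value is $\dim_BA$. $A$ is Minkowski nondegenerate if $0<\mathcal M_*^D(A)\le\mathcal M^{*D}(A)<\infty$ for some $D\ge0$ (then $D=\dim_BA$), and Minkowski measurable if moreover $\mathcal M_*^D(A)=\mathcal M^{*D}(A)$, the common value being denoted $\mathcal M^D(A)$. For a fixed $\delta>0$,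 the distance zeta function of $A$ is $\zeta_A(s)=\int_{A_\delta}d(x,A)^{s-N}\,dx$ for $\operatorname{Re}s$ sufficiently large; its abscissa of convergence is $D(\zeta_A)=\inf\{\sigma\ge0:\int_{A_\delta}d(x,A)^{\sigma-N}dx<\infty\}$. $D_{\rm mer}(f)$ is the infimum of all real $\sigma$ such that $f$ has a meromorphic extension to $\{\operatorname{Re}s>\sigma\}$; the extension is denoted by the same symbol. $\dim_{PC}A$ is the set of poles of $\zeta_A$ on the critical line $\{\operatorname{Re}s=D(\zeta_A)\}$. $\operatorname{res}(f,\omega)$ is the residue of $f$ at $\omega$ (equal to $0$ if $f$ is holomorphic at $\omega$). $G_0$ is the truncation of $G$ to $[0,T]$ (equal to $G$ on $[0,T]$ and $0$ elsewhere), and $\hat G_0(t)=\int_0^Te^{-2\pi i t\tau}G(\tau)\,d\tau$. *)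

theory Defs
  imports "HOL-Complex_Analysis.Complex_Analysis" "HOL-Library.Landau_Symbols"
begin

section \<open>Minkowski content and dimension\<close>

definition tube :: "'a::euclidean_space set \<Rightarrow> real \<Rightarrow> 'a set" where
  "tube A t = {x. infdist x A < t}"

abbreviation tube_volume :: "'a::euclidean_space set \<Rightarrow> real \<Rightarrow> real" where
  "tube_volume A t \<equiv> measure lebesgue (tube A t)"

definition upper_minkowski_content :: "real \<Rightarrow> 'a::euclidean_space set \<Rightarrow> ereal" where
  "upper_minkowski_content r A =
     Limsup (at_right 0) (\<lambda>t. ereal (tube_volume A t / t powr (real DIM('a) - r)))"

definition lower_minkowski_content :: "real \<Rightarrow> 'a::euclidean_space set \<Rightarrow> ereal" where
  "lower_minkowski_content r A =
     Liminf (at_right 0) (\<lambda>t. ereal (tube_volume A t / t powr (real DIM('a) - r)))"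

definition upper_minkowski_dim :: "'a::euclidean_space set \<Rightarrow> real" where
  "upper_minkowski_dim A = Inf {r. 0 < r \<and> upper_minkowski_content r A = 0}"

definition lower_minkowski_dim :: "'a::euclidean_space set \<Rightarrow> real" where
  "lower_minkowski_dim A = Inf {r. 0 < r \<and> lower_minkowski_content r A = 0}"

definition has_minkowski_dim :: "'a::euclidean_space set \<Rightarrow> real \<Rightarrow> bool" where
  "has_minkowski_dim A D \<longleftrightarrow> upper_minkowski_dim A = D \<and> lower_minkowski_dim A = D"

definition minkowski_nondegenerate :: "'a::euclidean_space set \<Rightarrow> bool" where
  "minkowski_nondegenerate A \<longleftrightarrow>
     (\<exists>D\<ge>0. 0 < lower_minkowski_content D A \<and>
            lower_minkowski_content D A \<le> upper_minkowski_content D A \<and>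
            upper_minkowski_content D A < \<infinity>)"

definition minkowski_measurable :: "'a::euclidean_space set \<Rightarrow> bool" where
  "minkowski_measurable A \<longleftrightarrow>
     (\<exists>D\<ge>0. 0 < lower_minkowski_content D A \<and>
            lower_minkowski_content D A = upper_minkowski_content D A \<and>
            upper_minkowski_content D A < \<infinity>)"

text \<open>The relation says that the \<open>D\<close>-dimensional content of \<open>A\<close> exists and equals \<open>M\<close>.\<close>

definition has_minkowski_content :: "real \<Rightarrow> 'a::euclidean_space set \<Rightarrow> real \<Rightarrow> bool" where
  "has_minkowski_content D A M \<longleftrightarrow>
     lower_minkowski_content D A = ereal M \<and> upper_minkowski_content D A = ereal M"


section \<open>The distance zeta function\<close>

text \<open>
  A real power of a distance \<open>d \<ge> 0\<close> with the value \<open>\<infinity>\<close> for \<open>d = 0\<close> and a negative exponent,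
  where the library's \<open>powr\<close> returns \<open>0\<close>. This matters when the closure of \<open>A\<close>
  has positive measure. (The value at \<open>d = 0\<close>, \<open>r = 0\<close> does not affect finiteness of the
  integral below, the tube being bounded.)
\<close>

definition dist_power :: "real \<Rightarrow> real \<Rightarrow> ennreal" where
  "dist_power d r = (if d = 0 \<and> r < 0 then \<infinity> else ennreal (d powr r))"

definition zeta_abscissa :: "real \<Rightarrow> 'a::euclidean_space set \<Rightarrow> real" where
  "zeta_abscissa \<delta> A =
     Inf {\<sigma>. 0 \<le> \<sigma> \<and>
       (\<integral>\<^sup>+x\<in>tube A \<delta>. dist_power (infdist x A) (\<sigma> - real DIM('a)) \<partial>lebesgue) < \<infinity>}"

text \<open>
  Only the values for \<open>Re s > zeta_abscissa \<delta> A\<close> are meaningful. There the convention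
  \<open>0 powr z = 0\<close> is harmless: either the closure of \<open>A\<close> is a null set, or the abscissa is
  the dimension of the space, so that the exponent has positive real part.
\<close>

definition distance_zeta :: "real \<Rightarrow> 'a::euclidean_space set \<Rightarrow> complex \<Rightarrow> complex" where
  "distance_zeta \<delta> A s =
     (LINT x:tube A \<delta>|lebesgue. complex_of_real (infdist x A) powr (s - of_nat DIM('a)))"

definition half_plane :: "real \<Rightarrow> complex set" where
  "half_plane \<sigma> = {s. \<sigma> < Re s}"


section \<open>Meromorphic continuation\<close>

text \<open>
  \<open>F\<close> is a meromorphic continuation to the domain \<open>U\<close> of the function \<open>f\<close>, whose own domain
  is \<open>S\<close>. Using \<open>nicely_meromorphic_on\<close> (removable singularities are removed, the value at a
  pole is \<open>0\<close>) makes the continuation unique pointwise and not only up to a discrete set.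
\<close>

definition meromorphic_continuation ::
    "(complex \<Rightarrow> complex) \<Rightarrow> complex set \<Rightarrow> (complex \<Rightarrow> complex) \<Rightarrow> complex set \<Rightarrow> bool" where
  "meromorphic_continuation f S F U \<longleftrightarrow>
     open U \<and> connected U \<and> F nicely_meromorphic_on U \<and> (\<forall>s\<in>S \<inter> U. F s = f s)"

definition meromorphic_abscissa :: "(complex \<Rightarrow> complex) \<Rightarrow> complex set \<Rightarrow> ereal" where
  "meromorphic_abscissa f S =
     Inf {ereal \<sigma> | \<sigma>. \<exists>F. meromorphic_continuation f S F (half_plane \<sigma>)}"

definition poles_in :: "(complex \<Rightarrow> complex) \<Rightarrow> complex set \<Rightarrow> complex set" where
  "poles_in F U = {s\<in>U. is_pole F s}"

text \<open>
  Poles of the distance zeta function on its critical line. By the identity theorem the choice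
  of the continuation to a neighbourhood of the closed half-plane is immaterial.
\<close>

definition principal_complex_dims :: "real \<Rightarrow> 'a::euclidean_space set \<Rightarrow> complex set" where
  "principal_complex_dims \<delta> A =
     {\<omega>. Re \<omega> = zeta_abscissa \<delta> A \<and>
        (\<exists>U F. {s. zeta_abscissa \<delta> A \<le> Re s} \<subseteq> U \<and>
           meromorphic_continuation (distance_zeta \<delta> A) (half_plane (zeta_abscissa \<delta> A)) F U \<and>
           is_pole F \<omega>)}"


section \<open>Periodic functions\<close>

definition has_minimal_period :: "(real \<Rightarrow> real) \<Rightarrow> real \<Rightarrow> bool" where
  "has_minimal_period G T \<longleftrightarrow>
     0 < T \<and> (\<forall>x. G (x + T) = G x) \<and> (\<forall>T'. 0 < T' \<and> (\<forall>x. G (x + T') = G x) \<longrightarrow> T \<le> T')"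

text \<open>Fourier transform of the truncation of \<open>G\<close> to \<open>[0, T]\<close>.\<close>

definition truncated_fourier :: "(real \<Rightarrow> real) \<Rightarrow> real \<Rightarrow> real \<Rightarrow> complex" where
  "truncated_fourier G T t =
     (LINT \<tau>:{0..T}|lebesgue. exp (- 2 * of_real pi * \<i> * of_real t * of_real \<tau>) * of_real (G \<tau>))"

end

theory Submission
  imports Defs
begin

text \<open>
  Put \<open>u = ln (1 / t)\<close> and \<open>W u = exp ((N - D) * u) * tube_volume A (exp (- u))\<close>, so that
  \<open>W = G + \<rho>\<close> with \<open>\<rho> u = O (exp (- \<alpha> * u))\<close>; the measurable case is that of a constant \<open>G\<close>.
  The level sets of the distance function at positive distances are null sets, so \<open>W\<close> is
  continuous, and so is \<open>G\<close>, being a locally uniform limit of translates of \<open>W\<close>.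
  By the layer cake formula, up to an explicit entire term and the factor \<open>N - s\<close>,
  the zeta function is the Laplace transform of \<open>W\<close> at \<open>z = s - D\<close>. The part coming from \<open>\<rho>\<close> is
  holomorphic for \<open>Re z > - \<alpha>\<close>, and that of the periodic \<open>G\<close> is an entire function divided by
  \<open>1 - exp (- T * z)\<close>, whose zeros are simple and give the poles. The numerator there is a Fourier
  coefficient of \<open>G\<close>, and the Riemann--Lebesgue lemma bounds the residues.
\<close>

section \<open>Poles of quotients and periodic integrals\<close>

text \<open>The hypothesis gives no regularity of \<open>G\<close> and only its nonnegativity, so
  continuity and strict positivity have to be extracted from the tube volumes. Positivity makes the
  contents infinite below \<open>D\<close>, which fixes the dimension and the abscissa; continuity
  gives attained extrema, strict inequalities for the mean and decay of the Fourier coefficients.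
  The condition \<open>D < N\<close> enters twice. It makes the closure of \<open>A\<close> a null
  set, so that the value of a power at distance 0 does not matter to the zeta function, and it keeps
  \<open>N - s\<close> from vanishing on the critical line, so that at the candidate poles the
  numerator vanishes exactly when the Fourier coefficient does. All terms are brought over one
  denominator, whose zeros are candidates only: where the coefficient vanishes the singularity is
  removable and \<open>remove_sings\<close> fills it. The residue formula then holds at every
  candidate, and the growth estimate can be stated for all \<open>k\<close>.\<close>

lemma nicely_meromorphic_on_eq:
  assumes f: "f nicely_meromorphic_on A" and g: "g nicely_meromorphic_on A"
    and A: "open A" "connected A"
    and B: "open B" "B \<noteq> {}" "B \<subseteq> A" "\<And>z. z \<in> B \<Longrightarrow> f z = g z"
    and z: "z \<in> A"
  shows "f z = g z" "is_pole f z \<longleftrightarrow> is_pole g z"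
proof -
  \<comment> \<open>At a common pole the plain difference may have a removable singularity with the
    wrong value, so the identity theorem is applied to its repaired version.\<close>
  define h where "h = remove_sings (\<lambda>w. f w - g w)"
  have mf: "f meromorphic_on A" and mg: "g meromorphic_on A"
    using f g by (auto simp: nicely_meromorphic_on_def)
  have md: "(\<lambda>w. f w - g w) meromorphic_on A"
    using mf mg by (intro meromorphic_intros)
  have h: "h nicely_meromorphic_on A"
    unfolding h_def by (rule remove_sings_nicely_meromorphic[OF md])
  have hB: "h w = 0" if "w \<in> B" for w
  proof -
    have "\<forall>\<^sub>F v in at w. v \<in> B"
      using B(1) that by (rule eventually_at_in_open')
    hence "\<forall>\<^sub>F v in at w. f v - g v = 0"
      by eventually_elim (simp add: B(4))
    hence "(\<lambda>v. f v - g v) \<midarrow>w\<rightarrow> 0"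
      by (rule tendsto_eventually)
    thus ?thesis unfolding h_def by (rule remove_sings_eqI)
  qed
  obtain b where b: "b \<in> B" using B(2) by blast
  have "\<forall>\<^sub>F v in at b. h v = 0"
    using eventually_at_in_open'[OF B(1) b] by eventually_elim (rule hB)
  hence "\<exists>\<^sub>F v in at b. h v = 0"
    by (simp add: eventually_frequently)
  hence h0: "h w = 0" if "w \<in> A" for w
    using frequently_eq_meromorphic_imp_constant[OF _ h A _ that, of 0 b] b B(3) by blast
  have "isolated_singularity_at (\<lambda>w. f w - g w) z"
    using md z by (meson meromorphic_on_altdef)
  hence "\<forall>\<^sub>F w in at z. h w = f w - g w"
    unfolding h_def by (rule eventually_remove_sings_eq_at)
  hence ev: "\<forall>\<^sub>F w in at z. f w = g w"
    using eventually_at_in_open'[OF A(1) z] by eventually_elim (simp add: h0)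
  show pole: "is_pole f z \<longleftrightarrow> is_pole g z"
    by (rule is_pole_cong[OF ev refl])
  have lim: "f \<midarrow>z\<rightarrow> c \<longleftrightarrow> g \<midarrow>z\<rightarrow> c" for c
    by (rule tendsto_cong[OF ev])
  \<comment> \<open>The functions agree near \<open>z\<close> except perhaps at \<open>z\<close>.
    Being nicely meromorphic, each takes the value 0 at a pole and its limit elsewhere, which
    settles \<open>z\<close> itself.\<close>
  have fz: "(is_pole f z \<and> f z = 0) \<or> f \<midarrow>z\<rightarrow> f z" and gz: "(is_pole g z \<and> g z = 0) \<or> g \<midarrow>z\<rightarrow> g z"
    using f g z by (auto simp: nicely_meromorphic_on_def)
  show "f z = g z"
    using fz gz pole lim LIM_unique not_tendsto_and_filterlim_at_infinity[of "at z"]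
    unfolding is_pole_def by (metis at_neq_bot)
qed

section \<open>Quotients of holomorphic functions at zeros of the denominator\<close>

context
  fixes P E :: "complex \<Rightarrow> complex" and H :: "complex set" and z :: complex
  assumes H: "open H" "connected H" and P: "P holomorphic_on H" and E: "E holomorphic_on H"
    and z: "z \<in> H"
begin

lemma quotient_at_nonzero:
  assumes "E z \<noteq> 0"
  shows "remove_sings (\<lambda>w. P w / E w) z = P z / E z" "\<not> is_pole (remove_sings (\<lambda>w. P w / E w)) z"
proof -
  have an: "(\<lambda>w. P w / E w) analytic_on {z}"
  proof (rule analytic_on_divide)
    show "P analytic_on {z}" "E analytic_on {z}"
      using P E H(1) z by (meson holomorphic_on_imp_analytic_at)+
  qed (use assms in auto)
  thus "remove_sings (\<lambda>w. P w / E w) z = P z / E z" by simp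
  have "remove_sings (\<lambda>w. P w / E w) analytic_on {z}"
    using an by (simp add: remove_sings_analytic_on)
  thus "\<not> is_pole (remove_sings (\<lambda>w. P w / E w)) z"
    using analytic_at_imp_no_pole by blast
qed

context
  fixes E' :: complex
  assumes E': "(E has_field_derivative E') (at z)" "E z = 0" "E' \<noteq> 0"
begin

lemma quotient_meromorphic: "(\<lambda>w. P w / E w) meromorphic_on H"
  using P E H(1)
  by (intro meromorphic_intros analytic_on_imp_meromorphic_on) (auto simp: analytic_on_open)

lemma quotient_isolated: "isolated_singularity_at (\<lambda>w. P w / E w) z"
  using quotient_meromorphic z by (auto simp: meromorphic_on_altdef)

text \<open>If \<open>P z = 0\<close>, dividing numerator and denominator by \<open>w - z\<close>
  shows that the quotient tends to \<open>deriv P z / E'\<close>, so the singularity is removable.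
  Otherwise the denominator tends to 0 through nonzero values while the numerator does not.\<close>

lemma quotient_pole_iff: "is_pole (remove_sings (\<lambda>w. P w / E w)) z \<longleftrightarrow> P z \<noteq> 0"
proof -
  have Ez: "((\<lambda>w. E w / (w - z)) \<longlongrightarrow> E') (at z)"
    using E'(1,2) by (simp add: has_field_derivative_iff)
  have ez: "eventually (\<lambda>w. E w \<noteq> 0) (at z)"
  proof -
    have "eventually (\<lambda>w. E w / (w - z) \<noteq> 0) (at z)"
      using tendsto_imp_eventually_ne[OF Ez E'(3)] .
    thus ?thesis by eventually_elim auto
  qed
  have Pz: "P field_differentiable at z"
    using P H z holomorphic_on_imp_differentiable_at by blast
  have "is_pole (\<lambda>w. P w / E w) z \<longleftrightarrow> P z \<noteq> 0"
  proof
    assume "P z \<noteq> 0"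
    have "E \<midarrow>z\<rightarrow> 0"
      using E'(1,2) DERIV_isCont isCont_def by metis
    hence "filterlim E (at 0) (at z)"
      using ez by (auto simp: filterlim_at)
    moreover have "isCont P z" using Pz field_differentiable_imp_continuous_at by blast
    ultimately show "is_pole (\<lambda>w. P w / E w) z"
      using is_pole_divide[of z P E] \<open>P z \<noteq> 0\<close> by blast
  next
    assume pole: "is_pole (\<lambda>w. P w / E w) z"
    show "P z \<noteq> 0"
    proof
      assume P0: "P z = 0"
      have "((\<lambda>w. P w / (w - z)) \<longlongrightarrow> deriv P z) (at z)"
        using Pz P0 DERIV_deriv_iff_field_differentiable[of P z] by (simp add: has_field_derivative_iff)
      hence "((\<lambda>w. (P w / (w - z)) / (E w / (w - z))) \<longlongrightarrow> deriv P z / E') (at z)"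
        using tendsto_divide Ez E'(3) by blast
      moreover have "eventually (\<lambda>w. (P w / (w - z)) / (E w / (w - z)) = P w / E w) (at z)"
        using eventually_neq_at_within[of z z UNIV] by eventually_elim auto
      ultimately have "((\<lambda>w. P w / E w) \<longlongrightarrow> deriv P z / E') (at z)"
        by (rule Lim_transform_eventually)
      thus False
        using pole not_tendsto_and_filterlim_at_infinity[of "at z"] unfolding is_pole_def by auto
    qed
  qed
  thus ?thesis
    using quotient_isolated by simp
qed

lemma quotient_zorder:
  assumes "P z \<noteq> 0"
  shows "zorder (remove_sings (\<lambda>w. P w / E w)) z = -1"
  using porder_simple_pole_deriv[OF P E H z E'(1) assms E'(2,3)] quotient_isolated by simp

text \<open>The case \<open>P z = 0\<close> is included: there the repaired quotient is holomorphic
  and both sides are 0.\<close>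

lemma quotient_residue: "residue (remove_sings (\<lambda>w. P w / E w)) z = P z / E'"
proof (cases "P z = 0")
  case True
  have "remove_sings (\<lambda>w. P w / E w) nicely_meromorphic_on H"
    by (rule remove_sings_nicely_meromorphic[OF quotient_meromorphic])
  hence "remove_sings (\<lambda>w. P w / E w) analytic_on {z}"
    using nicely_meromorphic_on_imp_analytic_at z quotient_pole_iff True by blast
  then obtain S where "open S" "z \<in> S" "remove_sings (\<lambda>w. P w / E w) holomorphic_on S"
    by (auto simp: analytic_at)
  thus ?thesis using True residue_holo by simp
next
  case False
  thus ?thesis
    using residue_simple_pole_deriv[OF P E H z E'(1) False E'(2,3)] quotient_isolated by simp
qed

end
end

section \<open>Integrals and Fourier coefficients of continuous periodic functions\<close>

lemma integral_periodic_shift: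
  fixes f :: "real \<Rightarrow> 'a::banach"
  assumes c: "continuous_on UNIV f" and per: "\<And>x. f (x + T) = f x" and T: "0 < T"
  shows "integral {a..a+T} f = integral {0..T} f"
proof -
  have int: "f integrable_on {a..b}" for a b
    using c continuous_on_subset integrable_continuous_interval by blast
  have shift: "integral {a+T..b+T} f = integral {a..b} f" for a b
    using integral_shift_real_ivl[of "a + T" T "b + T" f] by (simp add: per)
  \<comment> \<open>Whether or not the windows at \<open>a\<close> and \<open>b\<close> overlap,
    their integrals differ by those over \<open>{a..b}\<close> and \<open>{a+T..b+T}\<close>, which
    are translates of each other by one period.\<close>
  have nonneg: "integral {a..a+T} f = integral {b..b+T} f" if "a \<le> b" for a b
  proof (cases "b \<le> a + T")
    case True
    have "integral {a..a+T} f = integral {a..b} f + integral {b..a+T} f"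
      using Henstock_Kurzweil_Integration.integral_combine[of a b "a+T" f] that True int by simp
    moreover have "integral {b..b+T} f = integral {b..a+T} f + integral {a+T..b+T} f"
      using Henstock_Kurzweil_Integration.integral_combine[of b "a+T" "b+T" f] that True int by simp
    ultimately show ?thesis by (simp add: shift)
  next
    case False
    have "integral {a..b+T} f = integral {a..a+T} f + integral {a+T..b+T} f"
      using Henstock_Kurzweil_Integration.integral_combine[of a "a+T" "b+T" f] that T int by simp
    moreover have "integral {a..b+T} f = integral {a..b} f + integral {b..b+T} f"
      using Henstock_Kurzweil_Integration.integral_combine[of a b "b+T" f] that T int by simp
    ultimately show ?thesis by (simp add: shift)
  qed
  show ?thesis
    using nonneg[of a 0] nonneg[of 0 a] by (cases "a \<le> 0") auto
qed

lemma truncated_fourier_eq_integral: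
  assumes "continuous_on UNIV G"
  shows "truncated_fourier G T t =
    integral {0..T} (\<lambda>\<tau>. exp (- 2 * of_real pi * \<i> * of_real t * of_real \<tau>) * of_real (G \<tau>))"
proof -
  have "continuous_on {0..T} (\<lambda>\<tau>. exp (- 2 * of_real pi * \<i> * of_real t * of_real \<tau>) * complex_of_real (G \<tau>))"
    using assms by (intro continuous_intros continuous_on_subset[OF assms]) auto
  thus ?thesis
    unfolding truncated_fourier_def
    by (intro set_lebesgue_integral_eq_integral absolutely_integrable_continuous_real)
qed

lemma exp_int_periodic:
  fixes k :: int and T :: real
  assumes "T \<noteq> 0"
  shows "exp (- 2 * of_real pi * \<i> * of_real (of_int k / T) * of_real (\<tau> + T)) =
    exp (- 2 * complex_of_real pi * \<i> * of_real (of_int k / T) * of_real \<tau>)"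
proof -
  have "- 2 * complex_of_real pi * \<i> * of_real (of_int k / T) * of_real (\<tau> + T) =
    - 2 * of_real pi * \<i> * of_real (of_int k / T) * of_real \<tau> + \<i> * (of_int (- k) * (of_real pi * 2))"
    using assms by (simp add: field_simps)
  thus ?thesis
    by (simp only: exp_plus_2pin)
qed

text \<open>\<open>G\<close> is real-valued. This is the source of the symmetry of the pole set
  under \<open>k\<close> to \<open>- k\<close>.\<close>

lemma truncated_fourier_cnj:
  assumes "continuous_on UNIV G"
  shows "truncated_fourier G T (- t) = cnj (truncated_fourier G T t)"
  unfolding truncated_fourier_eq_integral[OF assms] integral_cnj
  by (simp add: exp_cnj)

text \<open>Shifting by half a period of the exponential flips its sign, so that the coefficient is
  half the integral of the exponential against a small increment of \<open>G\<close>.\<close>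

lemma truncated_fourier_small:
  assumes c: "continuous_on UNIV G" and per: "\<And>x. G (x + T) = G x" and T: "0 < T" and e: "0 < e"
  shows "\<exists>K::real. \<forall>k::int. K < \<bar>of_int k\<bar> \<longrightarrow> norm (truncated_fourier G T (of_int k / T)) \<le> e"
proof -
  \<comment> \<open>The shift \<open>h\<close> below satisfies |h| \<le> T, so one extra period on
    either side contains every shifted point.\<close>
  have "uniformly_continuous_on {-T..2*T} G"
    by (intro compact_uniformly_continuous continuous_on_subset[OF c]) auto
  then obtain d where d: "0 < d"
    "\<And>x y. x \<in> {-T..2*T} \<Longrightarrow> y \<in> {-T..2*T} \<Longrightarrow> dist y x < d \<Longrightarrow> dist (G y) (G x) < e / T"
    using e T unfolding uniformly_continuous_on_def by (metis divide_pos_pos)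
  \<comment> \<open>For \<open>h = T / (2 * k)\<close> the threshold 1 ensures |h| \<le> T and the
    threshold \<open>T / d\<close> ensures |h| < d.\<close>
  have "norm (truncated_fourier G T (of_int k / T)) \<le> e" if k: "max 1 (T / d) < \<bar>of_int k\<bar>" for k :: int
  proof -
    define E where "E = (\<lambda>\<tau>. exp (- 2 * complex_of_real pi * \<i> * of_real (of_int k / T) * of_real \<tau>))"
    define p where "p = (\<lambda>\<tau>. E \<tau> * complex_of_real (G \<tau>))"
    define h where "h = T / (2 * of_int k)"
    have k0: "k \<noteq> 0" using k by auto
    have cE: "continuous_on S E" for S unfolding E_def by (intro continuous_intros)
    have cG: "continuous_on S (\<lambda>x. complex_of_real (G x))" for S
      using continuous_on_of_real continuous_on_subset[OF c] by blast
    have cp: "continuous_on UNIV p"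
      unfolding p_def by (intro continuous_intros cE cG)
    have cph: "continuous_on S (\<lambda>\<tau>. p (\<tau> + h))" for S
      by (rule continuous_on_compose2[OF cp]) (auto intro!: continuous_intros)
    have pp: "p (x + T) = p x" for x
      unfolding p_def E_def using exp_int_periodic[of T k x] T per by simp
    have Eh: "E (\<tau> + h) = - E \<tau>" for \<tau>
    proof -
      have "- 2 * complex_of_real pi * \<i> * of_real (of_int k / T) * of_real (\<tau> + h) =
        - 2 * complex_of_real pi * \<i> * of_real (of_int k / T) * of_real \<tau> - of_real pi * \<i>"
        using T k0 by (simp add: h_def field_simps)
      thus ?thesis unfolding E_def by (simp only: exp_diff exp_pi_i') simp
    qed
    have eq: "p \<tau> + p (\<tau> + h) = E \<tau> * of_real (G \<tau> - G (\<tau> + h))" for \<tau>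
      by (simp add: p_def Eh algebra_simps)
    have "truncated_fourier G T (of_int k / T) = integral {0..T} p"
      unfolding truncated_fourier_eq_integral[OF c] p_def E_def ..
    moreover have "integral {0..T} (\<lambda>\<tau>. p (\<tau> + h)) = integral {0..T} p"
      using integral_shift_real_ivl[of h h "h + T" p] integral_periodic_shift[OF cp pp T, of h] by simp
    moreover have "integral {0..T} (\<lambda>\<tau>. p \<tau> + p (\<tau> + h)) = integral {0..T} p + integral {0..T} (\<lambda>\<tau>. p (\<tau> + h))"
      by (intro Henstock_Kurzweil_Integration.integral_add integrable_continuous_interval cph continuous_on_subset[OF cp]) auto
    ultimately have "2 * truncated_fourier G T (of_int k / T) = integral {0..T} (\<lambda>\<tau>. p \<tau> + p (\<tau> + h))"
      by simp
    moreover have "norm (integral {0..T} (\<lambda>\<tau>. p \<tau> + p (\<tau> + h))) \<le> e / T * (T - 0)"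
    proof (rule integral_bound)
      show "continuous_on {0..T} (\<lambda>\<tau>. p \<tau> + p (\<tau> + h))"
        by (intro continuous_intros cph continuous_on_subset[OF cp]) auto
      fix \<tau> assume \<tau>: "\<tau> \<in> {0..T}"
      have kk: "1 < \<bar>real_of_int k\<bar>" "T / d < \<bar>real_of_int k\<bar>" using k by auto
      have "\<bar>h\<bar> = T / (2 * \<bar>real_of_int k\<bar>)" using T by (simp add: h_def abs_mult)
      moreover have "T / (2 * \<bar>real_of_int k\<bar>) < d"
      proof -
        have "T < d * \<bar>real_of_int k\<bar>" using kk(2) d(1) by (simp add: field_simps)
        also have "\<dots> < d * (2 * \<bar>real_of_int k\<bar>)" using d(1) kk(1) by simp
        finally show ?thesis using kk(1) by (simp add: divide_less_eq)
      qed
      moreover have "T / (2 * \<bar>real_of_int k\<bar>) \<le> T"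
      proof -
        have "T * 1 \<le> T * (2 * \<bar>real_of_int k\<bar>)" using T kk(1) by (intro mult_left_mono) auto
        thus ?thesis using kk(1) by (simp add: divide_le_eq)
      qed
      ultimately have h: "\<bar>h\<bar> < d" "\<bar>h\<bar> \<le> T" by simp_all
      have "dist (G \<tau>) (G (\<tau> + h)) < e / T"
        using h \<tau> by (intro d(2)) (auto simp: dist_real_def)
      moreover have "norm (E \<tau>) = 1" by (simp add: E_def)
      ultimately show "norm (p \<tau> + p (\<tau> + h)) \<le> e / T"
        unfolding eq norm_mult by (simp add: dist_real_def del: of_real_diff)
    qed (use T in auto)
    ultimately have "norm (2 * truncated_fourier G T (of_int k / T)) \<le> e" using T by simp
    thus ?thesis using norm_ge_zero[of "truncated_fourier G T (of_int k / T)"] by (simp only: norm_mult norm_numeral)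
  qed
  thus ?thesis by blast
qed

text \<open>By periodicity the window of integration may start at \<open>y\<close>. A continuous
  nonnegative function with integral 0 vanishes on the window, but \<open>G - m\<close> is positive
  at \<open>y\<close>.\<close>

lemma periodic_mean_strict:
  fixes G :: "real \<Rightarrow> real"
  assumes c: "continuous_on UNIV G" and per: "\<And>x. G (x + T) = G x" and T: "0 < T"
    and le: "\<And>x. m \<le> G x" and y: "m < G y"
  shows "m * T < integral {0..T} G"
proof -
  have "integral {0..T} G = integral {y..y+T} G"
    using integral_periodic_shift[OF c per T] by simp
  moreover have "integral {y..y+T} (\<lambda>x. G x - m) \<noteq> 0"
  proof -
    have "continuous_on {y..y+T} (\<lambda>x. G x - m)"
      by (intro continuous_intros continuous_on_subset[OF c]) auto
    thus ?thesis
      using integral_eq_0_iff[of y "y + T" "\<lambda>x. G x - m"] T le y by force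
  qed
  moreover have "0 \<le> integral {y..y+T} (\<lambda>x. G x - m)"
    by (intro Henstock_Kurzweil_Integration.integral_nonneg integrable_continuous_interval
        continuous_intros continuous_on_subset[OF c]) (use le in auto)
  moreover have "integral {y..y+T} (\<lambda>x. G x - m) = integral {y..y+T} G - m * T"
  proof -
    have "G integrable_on {y..y+T}"
      by (intro integrable_continuous_interval continuous_on_subset[OF c]) auto
    thus ?thesis
      using Henstock_Kurzweil_Integration.integral_diff[of G "{y..y+T}" "\<lambda>_. m"] T by (auto simp: mult.commute)
  qed
  ultimately show ?thesis by simp
qed

section \<open>Laplace integrals\<close>

lemma periodic_of_int:
  fixes G :: "real \<Rightarrow> 'a"
  assumes "\<And>x. G (x + T) = G x"
  shows "G (x + of_int n * T) = G x"
proof -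
  have nat: "G (x + of_nat m * T) = G x" for x m
  proof (induction m)
    case (Suc m)
    have "G (x + of_nat (Suc m) * T) = G (x + of_nat m * T + T)"
      by (simp add: algebra_simps)
    thus ?case using assms Suc by simp
  qed simp
  show ?thesis
  proof (cases "0 \<le> n")
    case True
    thus ?thesis using nat[of x "nat n"] by simp
  next
    case False
    thus ?thesis using nat[of "x + of_int n * T" "nat (- n)"] by simp
  qed
qed

lemma periodic_attains:
  fixes G :: "real \<Rightarrow> real"
  assumes c: "continuous_on UNIV G" and per: "\<And>x. G (x + T) = G x" and T: "0 < T"
  shows "\<exists>a. \<forall>x. G a \<le> G x" "\<exists>b. \<forall>x. G x \<le> G b"
proof -
  have red: "\<exists>y\<in>{0..T}. G x = G y" for x
  proof
    show "G x = G (x + of_int (- \<lfloor>x / T\<rfloor>) * T)"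
      using periodic_of_int[of G T x "- \<lfloor>x / T\<rfloor>"] per by simp
    show "x + of_int (- \<lfloor>x / T\<rfloor>) * T \<in> {0..T}"
      using T floor_divide_lower[OF T, of x] floor_divide_upper[OF T, of x]
      by (auto simp: algebra_simps)
  qed
  have "compact {0..T}" "{0..T} \<noteq> {}" "continuous_on {0..T} G"
    using T c continuous_on_subset by auto
  thus "\<exists>a. \<forall>x. G a \<le> G x" "\<exists>b. \<forall>x. G x \<le> G b"
    using continuous_attains_inf[of "{0..T}" G] continuous_attains_sup[of "{0..T}" G] red by metis+
qed

section \<open>Laplace transforms of exponentially bounded functions\<close>

lemma exp_minus_set_integrable:
  assumes "0 < (a::real)"
  shows "set_integrable lborel {c..} (\<lambda>u. exp (- a * u))"
    "(LINT u:{c..}|lborel. exp (- a * u)) = exp (- a * c) / a"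
proof -
  have hi: "((\<lambda>x::real. exp (-a*x)) has_integral exp (-a*c)/a) {c..}"
    using assms by (rule has_integral_exp_minus_to_infinity)
  have "set_integrable lebesgue {c..} (\<lambda>u. exp (- a * u))"
    using hi by (intro nonnegative_absolutely_integrable_1) auto
  hence *: "integrable lebesgue (\<lambda>u. indicator {c..} u *\<^sub>R exp (- a * u))"
    by (simp add: set_integrable_def)
  thus int: "set_integrable lborel {c..} (\<lambda>u. exp (- a * u))"
    unfolding set_integrable_def by (subst (asm) integrable_completion) auto
  show "(LINT u:{c..}|lborel. exp (- a * u)) = exp (- a * c) / a"
    using set_borel_integral_eq_integral(2)[OF int] hi by (simp add: integral_unique)
qed

lemma laplace_continuous:
  fixes f :: "real \<Rightarrow> real"
  assumes cf: "continuous_on UNIV f"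
  shows "continuous_on S (\<lambda>u. exp (- z * of_real u) * complex_of_real (f u))"
  by (intro continuous_intros continuous_on_of_real continuous_on_subset[OF cf]) auto

lemma laplace_finite_holomorphic:
  fixes f :: "real \<Rightarrow> real"
  assumes cf: "continuous_on UNIV f"
  shows "(\<lambda>z. integral {a..b} (\<lambda>u. exp (- z * of_real u) * complex_of_real (f u))) holomorphic_on UNIV"
proof -
  have "(\<lambda>z. integral (cbox a b) (\<lambda>u. exp (- z * of_real u) * complex_of_real (f u))) holomorphic_on UNIV"
  proof (rule leibniz_rule_holomorphic)
    show "((\<lambda>z. exp (- z * of_real u) * complex_of_real (f u)) has_field_derivative
        - of_real u * exp (- z * of_real u) * complex_of_real (f u)) (at z within UNIV)" for z u
      by (auto intro!: derivative_eq_intros)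
    show "(\<lambda>u. exp (- z * of_real u) * complex_of_real (f u)) integrable_on cbox a b" for z
      by (intro integrable_continuous laplace_continuous[OF cf])
    have "continuous_on (UNIV \<times> cbox a b) (\<lambda>p. f (snd p))"
      by (rule continuous_on_compose2[OF cf]) (auto intro!: continuous_intros)
    thus "continuous_on (UNIV \<times> cbox a b) (\<lambda>(z, u). - of_real u * exp (- z * of_real u) * complex_of_real (f u))"
      unfolding case_prod_unfold by (intro continuous_intros)
  qed auto
  thus ?thesis by simp
qed

context
  fixes f :: "real \<Rightarrow> real" and C \<alpha> u0 :: real
  assumes cf: "continuous_on UNIV f" and bd: "\<And>u. u0 \<le> u \<Longrightarrow> \<bar>f u\<bar> \<le> C * exp (- \<alpha> * u)"
begin

lemma laplace_bound:
  assumes "u0 \<le> u"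
  shows "norm (exp (- z * of_real u) * complex_of_real (f u)) \<le> C * exp (- (Re z + \<alpha>) * u)"
proof -
  have "norm (exp (- z * of_real u) * complex_of_real (f u)) = exp (- Re z * u) * \<bar>f u\<bar>"
    by (simp add: norm_mult)
  also have "\<dots> \<le> exp (- Re z * u) * (C * exp (- \<alpha> * u))"
    using bd[OF assms] by (intro mult_left_mono) auto
  also have "\<dots> = C * exp (- (Re z + \<alpha>) * u)"
    by (simp add: exp_add[symmetric] algebra_simps)
  finally show ?thesis .
qed

lemma laplace_integrable:
  assumes z: "- \<alpha> < Re z"
  shows "set_integrable lborel {u0..} (\<lambda>u. exp (- z * of_real u) * complex_of_real (f u))"
proof (rule set_integrable_bound[where f = "\<lambda>u. C * exp (- (Re z + \<alpha>) * u)"])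
  show "set_integrable lborel {u0..} (\<lambda>u. C * exp (- (Re z + \<alpha>) * u))"
    using exp_minus_set_integrable(1)[of "Re z + \<alpha>" u0] z by (intro set_integrable_mult_right) auto
  have "(\<lambda>u. exp (- z * of_real u) * complex_of_real (f u)) \<in> borel_measurable borel"
    by (rule borel_measurable_continuous_onI[OF laplace_continuous[OF cf]])
  thus "set_borel_measurable lborel {u0..} (\<lambda>u. exp (- z * of_real u) * complex_of_real (f u))"
    unfolding set_borel_measurable_def by measurable
  have "norm (exp (- z * of_real u) * complex_of_real (f u)) \<le> norm (C * exp (- (Re z + \<alpha>) * u))"
    if "u0 \<le> u" for u
    using laplace_bound[OF that, of z] by simp
  thus "AE u in lborel. u \<in> {u0..} \<longrightarrow>
      norm (exp (- z * of_real u) * complex_of_real (f u)) \<le> norm (C * exp (- (Re z + \<alpha>) * u))"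
    by (intro AE_I2) auto
qed

text \<open>The integrals over \<open>{u0..u0 + n}\<close> are entire in \<open>z\<close>, and on a
  closed disc inside the half-plane all tails are dominated by a single exponential, so they
  converge locally uniformly.\<close>

lemma laplace_holomorphic:
  "(\<lambda>z. LINT u:{u0..}|lborel. exp (- z * of_real u) * complex_of_real (f u)) holomorphic_on {z. - \<alpha> < Re z}"
    (is "?L holomorphic_on ?S")
proof (rule holomorphic_uniform_sequence)
  show "open ?S" by (rule open_halfspace_Re_gt)
  show "(\<lambda>z. integral {u0..u0 + real n} (\<lambda>u. exp (- z * of_real u) * complex_of_real (f u))) holomorphic_on ?S" for n
    using laplace_finite_holomorphic[OF cf] holomorphic_on_subset by blast
  fix x assume x: "x \<in> ?S"
  \<comment> \<open>Half the distance from \<open>x\<close> to the line Re z = - \<alpha>, hence a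
    lower bound for the decay rate on the whole disc of radius \<open>b\<close>.\<close>
  define b where "b = (Re x + \<alpha>) / 2"
  have b: "0 < b" using x by (simp add: b_def)
  have re: "b \<le> Re z + \<alpha>" if "z \<in> cball x b" for z
    using abs_Re_le_cmod[of "x - z"] that by (simp add: dist_norm b_def abs_if field_simps split: if_splits)
  have C: "0 \<le> C"
    using order_trans[OF abs_ge_zero bd[OF order_refl]] by (simp add: zero_le_mult_iff)
  \<comment> \<open>\<open>u0\<close> may be negative. Once the tail lies in u \<ge> 0, replacing
    the rate \<open>Re z + \<alpha>\<close> by the smaller \<open>b\<close> can only enlarge the
    exponential.\<close>
  have diff: "norm (integral {u0..u0 + real n} (\<lambda>u. exp (- z * of_real u) * complex_of_real (f u)) - ?L z)
      \<le> C * exp (- b * (u0 + real n)) / b"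
    if z: "z \<in> cball x b" and n: "0 \<le> u0 + real n" for z n
  proof -
    let ?g = "\<lambda>u. exp (- z * of_real u) * complex_of_real (f u)"
    have int: "set_integrable lborel {u0..} ?g"
      using re[OF z] b by (intro laplace_integrable) auto
    have i1: "set_integrable lborel {u0..u0 + real n} ?g" and i2: "set_integrable lborel {u0 + real n<..} ?g"
      by (rule set_integrable_subset[OF int]; auto)+
    have un: "{u0..} = {u0..u0 + real n} \<union> {u0 + real n<..}" by auto
    have "?L z = (LINT u:{u0..u0 + real n}|lborel. ?g u) + (LINT u:{u0 + real n<..}|lborel. ?g u)"
      unfolding un by (rule set_integral_Un[OF _ i1 i2]) auto
    also have "(LINT u:{u0..u0 + real n}|lborel. ?g u) = integral {u0..u0 + real n} ?g"
      by (rule set_borel_integral_eq_integral(2)[OF i1])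
    finally have "norm (integral {u0..u0 + real n} ?g - ?L z) = norm (LINT u:{u0 + real n<..}|lborel. ?g u)"
      by (simp add: norm_minus_commute)
    also have "\<dots> \<le> (LINT u:{u0 + real n<..}|lborel. norm (?g u))"
      by (rule set_integral_norm_bound[OF i2])
    also have "\<dots> \<le> (LINT u:{u0 + real n..}|lborel. C * exp (- b * u))"
      unfolding set_lebesgue_integral_def
    proof (rule integral_mono)
      show "integrable lborel (\<lambda>u. indicator {u0 + real n<..} u *\<^sub>R norm (?g u))"
        using set_integrable_norm[OF i2] by (simp add: set_integrable_def)
      show "integrable lborel (\<lambda>u. indicator {u0 + real n..} u *\<^sub>R (C * exp (- b * u)))"
        using set_integrable_mult_right[of C, OF exp_minus_set_integrable(1)[OF b]]
        by (simp add: set_integrable_def)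
      show "indicator {u0 + real n<..} u *\<^sub>R norm (?g u) \<le> indicator {u0 + real n..} u *\<^sub>R (C * exp (- b * u))" for u
      proof (cases "u0 + real n < u")
        case True
        have "norm (?g u) \<le> C * exp (- (Re z + \<alpha>) * u)"
          using True by (intro laplace_bound) linarith
        also have "\<dots> \<le> C * exp (- b * u)"
          using C mult_right_mono[OF re[OF z], of u] True n
          by (intro mult_left_mono) (auto simp: algebra_simps)
        finally show ?thesis using True by simp
      qed (use C in \<open>auto simp: indicator_def\<close>)
    qed
    also have "\<dots> = C * exp (- b * (u0 + real n)) / b"
      using exp_minus_set_integrable(2)[OF b] by simp
    finally show ?thesis .
  qed
  have "(\<lambda>n. C * exp (- b * (u0 + real n)) / b) \<longlonglongrightarrow> 0"
  proof -
    have "(\<lambda>n. exp (- b) ^ n) \<longlonglongrightarrow> 0"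
      using b by (intro LIMSEQ_power_zero) simp
    hence "(\<lambda>n. C * exp (- b * u0) / b * exp (- b) ^ n) \<longlonglongrightarrow> 0"
      by (rule tendsto_mult_right_zero)
    moreover have "C * exp (- b * (u0 + real n)) / b = C * exp (- b * u0) / b * exp (- b) ^ n" for n
      by (simp add: exp_of_nat_mult[symmetric] exp_add[symmetric] algebra_simps)
    ultimately show ?thesis by (simp only:)
  qed
  hence lim: "\<forall>\<^sub>F n in sequentially. C * exp (- b * (u0 + real n)) / b < e" if "0 < e" for e
    using that by (rule order_tendstoD(2))
  have "\<forall>\<^sub>F n in sequentially. 0 \<le> u0 + real n"
    by (rule eventually_sequentiallyI[of "nat \<lceil>- u0\<rceil>"]) linarith
  note large = this
  have "uniform_limit (cball x b) (\<lambda>n z. integral {u0..u0 + real n} (\<lambda>u. exp (- z * of_real u) * complex_of_real (f u))) ?L sequentially"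
    unfolding uniform_limit_iff dist_norm
  proof (intro allI impI)
    fix e :: real assume "0 < e"
    from lim[OF this] large
    show "\<forall>\<^sub>F n in sequentially. \<forall>z\<in>cball x b.
        norm (integral {u0..u0 + real n} (\<lambda>u. exp (- z * of_real u) * complex_of_real (f u)) - ?L z) < e"
      by eventually_elim (use diff le_less_trans in blast)
  qed
  moreover have "cball x b \<subseteq> ?S" using re b by force
  ultimately show "\<exists>d>0. cball x d \<subseteq> ?S \<and> uniform_limit (cball x d) (\<lambda>n z. integral {u0..u0 + real n} (\<lambda>u. exp (- z * of_real u) * complex_of_real (f u))) ?L sequentially"
    using b by blast
qed

end

section \<open>Laplace transforms of periodic functions\<close>

lemma set_integral_atLeast_shift:
  fixes g :: "real \<Rightarrow> 'b::{banach, second_countable_topology}"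
  shows "(LINT u:{a + t..}|lborel. g u) = (LINT u:{a..}|lborel. g (t + u))"
proof -
  have "(LINT u:{a + t..}|lborel. g u) = (LINT u|lborel. indicator {a + t..} (t + 1 * u) *\<^sub>R g (t + 1 * u))"
    unfolding set_lebesgue_integral_def by (subst lborel_integral_real_affine[of 1 _ t]) simp_all
  also have "(\<lambda>u. indicator {a + t..} (t + 1 * u) *\<^sub>R g (t + 1 * u)) = (\<lambda>u. indicator {a..} u *\<^sub>R g (t + u))"
    by (auto simp: indicator_def)
  finally show ?thesis unfolding set_lebesgue_integral_def .
qed

text \<open>The part of the transform beyond one period is the whole transform times
  \<open>exp (- T * z)\<close>, which sums the geometric series over the periods. The multiplied
  form is the one that survives continuation: its right-hand side makes sense for every
  \<open>z\<close>.\<close>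

lemma laplace_periodic:
  fixes G :: "real \<Rightarrow> real"
  assumes c: "continuous_on UNIV G" and per: "\<And>x. G (x + T) = G x" and T: "0 < T" and z: "0 < Re z"
  shows "set_integrable lborel {u0..} (\<lambda>u. exp (- z * of_real u) * complex_of_real (G u))"
    and "(LINT u:{u0..}|lborel. exp (- z * of_real u) * complex_of_real (G u)) * (1 - exp (- of_real T * z)) =
      integral {u0..u0 + T} (\<lambda>u. exp (- z * of_real u) * complex_of_real (G u))"
proof -
  let ?g = "\<lambda>u. exp (- z * of_real u) * complex_of_real (G u)"
  let ?I = "LINT u:{u0..}|lborel. ?g u"
  obtain a b where ab: "\<And>x. G a \<le> G x" "\<And>x. G x \<le> G b"
    using periodic_attains[of G T, OF c per T] by metis
  define B where "B = \<bar>G a\<bar> + \<bar>G b\<bar>"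
  have "\<bar>G x\<bar> \<le> B" for x using ab(1)[of x] ab(2)[of x] by (auto simp: B_def)
  \<comment> \<open>A bounded function satisfies the exponential bound with rate 0, whence
    convergence for Re z > 0.\<close>
  hence bd: "\<bar>G x\<bar> \<le> B * exp (- 0 * x)" for x by simp
  show int: "set_integrable lborel {u0..} ?g"
    using laplace_integrable[of G u0 B 0 z, OF c bd] z by simp
  have i1: "set_integrable lborel {u0..<u0 + T} ?g" and i2: "set_integrable lborel {u0 + T..} ?g"
    by (rule set_integrable_subset[OF int]; use T in auto)+
  have un: "{u0..} = {u0..<u0 + T} \<union> {u0 + T..}" using T by auto
  have "?I = (LINT u:{u0..<u0 + T}|lborel. ?g u) + (LINT u:{u0 + T..}|lborel. ?g u)"
    unfolding un by (rule set_integral_Un[OF _ i1 i2]) auto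
  also have "(LINT u:{u0..<u0 + T}|lborel. ?g u) = integral {u0..<u0 + T} ?g"
    by (rule set_borel_integral_eq_integral(2)[OF i1])
  also have "\<dots> = integral {u0..u0 + T} ?g"
    by (rule integral_spike_set) (auto intro!: negligible_subset[OF negligible_sing[of "u0 + T"]])
  also have "(LINT u:{u0 + T..}|lborel. ?g u) = (LINT u:{u0..}|lborel. ?g (T + u))"
    by (rule set_integral_atLeast_shift)
  also have "(\<lambda>u. ?g (T + u)) = (\<lambda>u. exp (- of_real T * z) * ?g u)"
    using per by (simp add: algebra_simps exp_add[symmetric] fun_eq_iff)
  also have "(LINT u:{u0..}|lborel. exp (- of_real T * z) * ?g u) = exp (- of_real T * z) * ?I"
    by simp
  finally show "?I * (1 - exp (- of_real T * z)) = integral {u0..u0 + T} ?g"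
    by (simp add: algebra_simps)
qed

text \<open>At these values of \<open>z\<close> the integrand itself has period \<open>T\<close>, so
  the window at \<open>u0\<close> can be moved to \<open>{0..T}\<close>. With
  \<open>u0 = - ln \<delta>\<close> this is how the radius disappears from the residues.\<close>

lemma laplace_period_eq_truncated_fourier:
  fixes G :: "real \<Rightarrow> real" and k :: int
  assumes c: "continuous_on UNIV G" and per: "\<And>x. G (x + T) = G x" and T: "0 < T"
  shows "integral {u0..u0 + T} (\<lambda>u. exp (- (of_real (2 * pi / T) * \<i> * of_int k) * of_real u) * complex_of_real (G u))
    = truncated_fourier G T (of_int k / T)"
proof -
  let ?p = "\<lambda>\<tau>. exp (- 2 * of_real pi * \<i> * of_real (of_int k / T) * of_real \<tau>) * complex_of_real (G \<tau>)"
  have eq: "exp (- (of_real (2 * pi / T) * \<i> * of_int k) * of_real u) * complex_of_real (G u) = ?p u" for u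
    by (simp add: field_simps)
  have "continuous_on UNIV ?p"
    by (intro continuous_intros continuous_on_of_real c)
  moreover have "?p (x + T) = ?p x" for x
    using exp_int_periodic[of T k x] T per by simp
  ultimately have "integral {u0..u0 + T} ?p = integral {0..T} ?p"
    using T integral_periodic_shift by blast
  thus ?thesis
    unfolding eq truncated_fourier_eq_integral[OF c] .
qed

section \<open>Volumes of tubes\<close>

lemma open_tube: "open (tube A t)"
  unfolding tube_def by (intro open_Collect_less continuous_intros)

lemma tube_mono: "s \<le> t \<Longrightarrow> tube A s \<subseteq> tube A t"
  by (auto simp: tube_def)

lemma infdist_closure: "infdist x (closure A) = infdist x A"
  by (simp add: infdist_eq_setdist)

lemma infdist_attains_closure:
  fixes A :: "'a::heine_borel set"
  assumes "A \<noteq> {}"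
  shows "\<exists>a\<in>closure A. infdist x A = dist x a"
proof -
  have "closure A \<noteq> {}" using assms by simp
  from infdist_attains_inf[OF closed_closure this, of x] show ?thesis
    unfolding infdist_closure by blast
qed

lemma bounded_tube:
  assumes "bounded A" "A \<noteq> {}"
  shows "bounded (tube A t)"
proof (cases "0 < t")
  case True
  have "compact {x. infdist x (closure A) \<le> t}"
    using assms True by (intro compact_infdist_le) auto
  hence "bounded {x. infdist x A \<le> t}"
    unfolding infdist_closure by (rule compact_imp_bounded)
  thus ?thesis by (rule bounded_subset) (auto simp: tube_def)
next
  case False
  hence "tube A t = {}" by (auto simp: tube_def not_less intro: order_trans[OF _ infdist_nonneg])
  thus ?thesis by simp
qed

lemma lmeasurable_tube: "bounded A \<Longrightarrow> A \<noteq> {} \<Longrightarrow> tube A t \<in> lmeasurable"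
  by (intro lmeasurable_open bounded_tube open_tube)

text \<open>Distinct small shifts of \<open>E\<close> along \<open>v\<close> give infinitely many
  disjoint sets of equal measure inside one bounded set.\<close>

lemma disjoint_translates_negligible:
  fixes E :: "'a::euclidean_space set"
  assumes E: "compact E" and h: "0 < h"
    and disj: "\<And>x s. x \<in> E \<Longrightarrow> 0 < s \<Longrightarrow> s < h \<Longrightarrow> x + s *\<^sub>R v \<notin> E"
  shows "negligible E"
proof -
  \<comment> \<open>The offsets are strictly decreasing and lie in (0, h / 2], so any two differ by
    a positive amount less than \<open>h\<close>.\<close>
  define F where "F = (\<lambda>n::nat. (+) ((h / (2 * (real n + 1))) *\<^sub>R v) ` E)"
  have Fm: "F n \<in> lmeasurable" "measure lebesgue (F n) = measure lebesgue E" for n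
    using lmeasurable_compact[OF E] by (auto simp: F_def measurable_translation measure_translation)
  have disjF: "disjnt (F m) (F n)" if "m < n" for m n
  proof -
    let ?s = "\<lambda>n. h / (2 * (real n + 1))"
    have s: "?s n < ?s m" using that h by (intro divide_strict_left_mono) auto
    have "?s m \<le> h / 2" using h by (intro divide_left_mono) auto
    moreover have "0 < ?s n" using h by simp
    ultimately have s2: "?s m - ?s n < h" using h by linarith
    have False if "x \<in> E" "y \<in> E" "?s m *\<^sub>R v + x = ?s n *\<^sub>R v + y" for x y
    proof -
      have "y = x + (?s m - ?s n) *\<^sub>R v" using that(3) by (simp add: algebra_simps)
      thus False using disj[OF that(1), of "?s m - ?s n"] s s2 that(2) by simp
    qed
    thus ?thesis unfolding F_def disjnt_def by fast
  qed
  obtain B where B: "B \<in> lmeasurable" "\<And>n. F n \<subseteq> B"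
  proof -
    have "bounded (\<Union>n. F n)"
    proof -
      obtain b where b: "\<And>x. x \<in> E \<Longrightarrow> norm x \<le> b" using compact_imp_bounded[OF E] by (auto simp: bounded_iff)
      have "norm y \<le> h * norm v + b" if "y \<in> F n" for y n
      proof -
        from that obtain x where x: "x \<in> E" "y = (h / (2 * (real n + 1))) *\<^sub>R v + x"
          unfolding F_def by blast
        have "h / (2 * (real n + 1)) \<le> h" using h by (simp add: divide_le_eq)
        hence "norm ((h / (2 * (real n + 1))) *\<^sub>R v) \<le> h * norm v"
          using h mult_right_mono[of "h / (2 * (real n + 1))" h "norm v"] by simp
        thus ?thesis unfolding x(2)
          using norm_triangle_ineq[of "(h / (2 * (real n + 1))) *\<^sub>R v" x] b[OF x(1)] by linarith
      qed
      thus ?thesis unfolding bounded_iff by blast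
    qed
    from bounded_subset_ballD[OF this, of 0] obtain r where "(\<Union>n. F n) \<subseteq> ball 0 r" by blast
    thus ?thesis using that[of "ball 0 r"] by auto
  qed
  have "real n * measure lebesgue E \<le> measure lebesgue B" for n
  proof -
    have "real n * measure lebesgue E = (\<Sum>i<n. measure lebesgue (F i))" by (simp add: Fm)
    also have "\<dots> = measure lebesgue (\<Union>i\<in>{..<n}. F i)"
    proof (rule measure_UNION'[symmetric])
      show "pairwise (\<lambda>i j. disjnt (F i) (F j)) {..<n}"
        using disjF by (auto simp: pairwise_def) (metis disjnt_sym linorder_neqE_nat)
    qed (use Fm in auto)
    also have "\<dots> \<le> measure lebesgue B"
      using B Fm by (intro measure_mono_fmeasurable) (auto intro: fmeasurableD)
    finally show ?thesis .
  qed
  hence "measure lebesgue E = 0"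
    by (metis less_eq_real_def measure_nonneg reals_Archimedean3 linorder_not_le order.asym)
  thus ?thesis using lmeasurable_compact[OF E] by (simp add: negligible_iff_measure0)
qed

text \<open>A point at distance \<open>t > 0\<close> moves off the level set when pushed towards a nearest
  point, hence also along some coordinate direction, for a uniform length of time on each of
  countably many compact pieces.\<close>

lemma negligible_infdist_level:
  fixes A :: "'a::euclidean_space set"
  assumes A: "bounded A" "A \<noteq> {}" and t: "0 < t"
  shows "negligible {x. infdist x A = t}"
proof -
  define E where "E = (\<lambda>v n. {x. infdist x A = t \<and> (\<exists>a\<in>closure A. dist x a = t \<and> inverse (real (Suc n)) \<le> v \<bullet> (a - x))})"
  have comp: "compact (E v n)" for v n
  proof -
    \<comment> \<open>The existential quantifier over nearest points is a projection:
      \<open>E v n\<close> is the continuous image of a compact set of pairs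
      \<open>(a, x - a)\<close>.\<close>
    define K where "K = closure A \<times> cball (0::'a) t \<inter> {p. infdist (fst p + snd p) A = t \<and> norm (snd p) = t \<and> inverse (real (Suc n)) \<le> v \<bullet> (- snd p)}"
    have "closed {p::'a\<times>'a. infdist (fst p + snd p) A = t \<and> norm (snd p) = t \<and> inverse (real (Suc n)) \<le> v \<bullet> (- snd p)}"
      by (intro closed_Collect_conj closed_Collect_eq closed_Collect_le continuous_intros)
    hence "compact K" unfolding K_def
      using A by (intro compact_Int_closed compact_Times) auto
    moreover have "E v n = (\<lambda>p. fst p + snd p) ` K"
    proof (intro equalityI subsetI)
      fix x assume "x \<in> E v n"
      then obtain a where "a \<in> closure A" "infdist x A = t" "dist x a = t" "inverse (real (Suc n)) \<le> v \<bullet> (a - x)"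
        by (auto simp: E_def)
      hence "(a, x - a) \<in> K" by (auto simp: K_def dist_norm norm_minus_commute inner_diff_right)
      thus "x \<in> (\<lambda>p. fst p + snd p) ` K" by force
    next
      fix x assume "x \<in> (\<lambda>p. fst p + snd p) ` K"
      then obtain a y where ay: "(a, y) \<in> K" "x = a + y" by auto
      thus "x \<in> E v n"
        unfolding E_def by (auto simp: K_def dist_norm intro!: bexI[of _ a])
    qed
    ultimately show ?thesis
      by (auto intro!: compact_continuous_image continuous_intros)
  qed
  have neg: "negligible (E v n)" if v: "norm v = 1" for v n
  proof (rule disjoint_translates_negligible[OF comp])
    fix x s assume x: "x \<in> E v n" and s: "0 < s" "s < inverse (real (Suc n))"
    obtain a where a: "a \<in> closure A" "dist x a = t" "inverse (real (Suc n)) \<le> v \<bullet> (a - x)"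
      using x by (auto simp: E_def)
    \<comment> \<open>Moving by \<open>s\<close> along \<open>v\<close> changes the squared distance
      to \<open>a\<close> by s^2 - 2 s (v . (a - x)), which is negative because 0 < s < v . (a - x).
      The moved point is then at distance less than \<open>t\<close> from \<open>A\<close>.\<close>
    have "(dist (x + s *\<^sub>R v) a)\<^sup>2 = (norm (s *\<^sub>R v - (a - x)))\<^sup>2" by (simp add: dist_norm algebra_simps)
    also have "\<dots> = s\<^sup>2 - 2 * s * (v \<bullet> (a - x)) + t\<^sup>2"
    proof -
      have "(norm (s *\<^sub>R v - z))\<^sup>2 = s\<^sup>2 * (v \<bullet> v) - 2 * s * (v \<bullet> z) + (norm z)\<^sup>2" for z
        unfolding power2_norm_eq_inner inner_diff_left inner_diff_right
        by (simp add: inner_commute power2_eq_square algebra_simps)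
      moreover have "v \<bullet> v = 1" using v by (simp add: dot_square_norm)
      moreover have "norm (a - x) = t" using a(2) by (simp add: dist_norm norm_minus_commute)
      ultimately show ?thesis by simp
    qed
    also have "\<dots> < t\<^sup>2"
    proof -
      have "s * s < s * (v \<bullet> (a - x))" using s a(3) by (intro mult_strict_left_mono) auto
      moreover have "0 < s * s" using s by simp
      ultimately show ?thesis by (simp add: power2_eq_square)
    qed
    finally have "dist (x + s *\<^sub>R v) a < t" using t by (simp add: power_less_imp_less_base)
    moreover have "infdist (x + s *\<^sub>R v) (closure A) \<le> dist (x + s *\<^sub>R v) a" by (rule infdist_le[OF a(1)])
    hence "infdist (x + s *\<^sub>R v) A \<le> dist (x + s *\<^sub>R v) a" unfolding infdist_closure .
    ultimately show "x + s *\<^sub>R v \<notin> E v n" by (auto simp: E_def)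
  qed simp
  \<comment> \<open>Some coordinate of \<open>a - x\<close> is nonzero but may have either sign, so
    both orientations of each basis vector occur.\<close>
  have sub: "{x. infdist x A = t} \<subseteq> (\<Union>v\<in>Basis \<union> uminus ` Basis. \<Union>n. E v n)"
  proof
    fix x assume x: "x \<in> {x. infdist x A = t}"
    obtain a where a: "a \<in> closure A" "infdist x A = dist x a"
      using infdist_attains_closure[OF A(2)] by blast
    have "a - x \<noteq> 0" using a x t by auto
    then obtain b where b: "b \<in> Basis" "b \<bullet> (a - x) \<noteq> 0"
      by (metis euclidean_all_zero_iff inner_commute)
    obtain v where v: "v \<in> Basis \<union> uminus ` Basis" "0 < v \<bullet> (a - x)"
    proof (cases "0 < b \<bullet> (a - x)")
      case False
      thus ?thesis using b that[of "- b"] by auto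
    qed (use b that in auto)
    obtain n where "inverse (real (Suc n)) < v \<bullet> (a - x)" using reals_Archimedean[OF v(2)] by blast
    hence "x \<in> E v n" using a x by (auto simp: E_def intro!: bexI[of _ a])
    thus "x \<in> (\<Union>v\<in>Basis \<union> uminus ` Basis. \<Union>n. E v n)" using v(1) by blast
  qed
  have "negligible (\<Union>v\<in>Basis \<union> uminus ` Basis. \<Union>n. E v n)"
  proof (intro negligible_countable_Union)
    show "countable ((\<lambda>v. \<Union>n. E v n) ` (Basis \<union> uminus ` Basis))"
      by (intro countable_image countable_finite) auto
  qed (auto intro!: neg negligible_countable_Union)
  thus ?thesis using sub negligible_subset by blast
qed

text \<open>Dominated convergence along a sequence of radii tending to \<open>t\<close>: the
  indicators of the tubes converge at every point whose distance from \<open>A\<close> is not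
  \<open>t\<close>, and the tube of a radius bounding the sequence dominates.\<close>

lemma continuous_on_tube_volume:
  fixes A :: "'a::euclidean_space set"
  assumes A: "bounded A" "A \<noteq> {}"
  shows "continuous_on {0<..} (tube_volume A)"
proof -
  have "isCont (tube_volume A) t" if t: "0 < t" for t
    unfolding continuous_at_sequentially
  proof (intro allI impI)
    fix u assume u: "u \<longlonglongrightarrow> t"
    have "Bseq u" using convergent_imp_Bseq convergentI[OF u] by blast
    then obtain B where "\<And>n. norm (u n) \<le> B" unfolding Bseq_def by blast
    hence B: "u n \<le> B" for n using abs_ge_self[of "u n"] order_trans by (metis real_norm_def)
    have ind: "(\<lambda>x. indicator (tube A s) x :: real) \<in> borel_measurable lebesgue" for s
      using lmeasurable_tube[OF A, of s] by (auto intro: fmeasurableD)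
    have "(\<lambda>n. LINT x|lebesgue. indicat_real (tube A (u n)) x) \<longlonglongrightarrow> (LINT x|lebesgue. indicat_real (tube A t) x)"
    proof (rule integral_dominated_convergence[where w = "indicator (tube A B)"])
      show "integrable lebesgue (indicator (tube A B) :: 'a \<Rightarrow> real)"
        using lmeasurable_tube[OF A, of B]
        by (intro integrable_real_indicator) (auto simp: fmeasurable_def)
      have "AE x in lebesgue. x \<notin> {x. infdist x A = t}"
        using negligible_infdist_level[OF A t] by (intro AE_not_in) (simp add: negligible_iff_null_sets)
      thus "AE x in lebesgue. (\<lambda>n. indicator (tube A (u n)) x :: real) \<longlonglongrightarrow> indicator (tube A t) x"
      proof (rule AE_mp, intro AE_I2 impI)
        fix x assume "x \<notin> {x. infdist x A = t}"
        hence "infdist x A < t \<or> t < infdist x A" by auto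
        hence "\<forall>\<^sub>F n in sequentially. (infdist x A < u n \<longleftrightarrow> infdist x A < t)"
        proof
          assume l: "infdist x A < t"
          show ?thesis using order_tendstoD(1)[OF u l] by eventually_elim (use l in auto)
        next
          assume l: "t < infdist x A"
          show ?thesis using order_tendstoD(2)[OF u l] by eventually_elim (use l in auto)
        qed
        hence "\<forall>\<^sub>F n in sequentially. indicator (tube A (u n)) x = (indicator (tube A t) x :: real)"
          by eventually_elim (simp add: tube_def indicator_def)
        thus "(\<lambda>n. indicator (tube A (u n)) x :: real) \<longlonglongrightarrow> indicator (tube A t) x"
          by (rule tendsto_eventually)
      qed
      show "AE x in lebesgue. norm (indicator (tube A (u n)) x :: real) \<le> indicator (tube A B) x" for n
        using tube_mono[OF B, of A n] by (intro AE_I2) (auto simp: indicator_def)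
    qed (use ind in auto)
    thus "(tube_volume A \<circ> u) \<longlonglongrightarrow> tube_volume A t"
      by (simp add: o_def)
  qed
  thus ?thesis by (simp add: continuous_on_eq_continuous_at open_greaterThan)
qed

section \<open>The layer cake formula\<close>

text \<open>The factor \<open>c\<close> stays on the left so that c = 0 is covered, which is the
  value s = N in the layer cake formula.\<close>

lemma exp_interval_integral:
  fixes c :: complex
  assumes "a \<le> b"
  shows "c * (LINT u:{a..<b}|lborel. exp (c * of_real u)) = exp (c * of_real b) - exp (c * of_real a)"
proof -
  let ?f = "\<lambda>u::real. exp (c * of_real u)"
  have int: "set_integrable lborel {a..b} ?f"
    by (intro borel_integrable_atLeastAtMost' continuous_intros)
  hence int': "set_integrable lborel {a..<b} ?f"
    by (rule set_integrable_subset) auto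
  have "((\<lambda>u. c * ?f u) has_integral (?f b - ?f a)) {a..b}"
    using assms
    by (intro fundamental_theorem_of_calculus)
       (auto intro!: derivative_eq_intros has_vector_derivative_real_field)
  hence "c * integral {a..b} ?f = ?f b - ?f a"
    by (metis integral_unique Henstock_Kurzweil_Integration.integral_mult_right)
  moreover have "integral {a..b} ?f = integral {a..<b} ?f"
    by (rule integral_spike_set) (auto intro!: negligible_subset[OF negligible_sing[of b]])
  ultimately show ?thesis
    using set_borel_integral_eq_integral(2)[OF int'] by simp
qed

text \<open>The substitution \<open>t = exp (- u)\<close> in the layer cake formula.\<close>

lemma distance_zeta_layer_cake:
  fixes A :: "'a::euclidean_space set" and s :: complex and \<delta> :: real
  defines "N \<equiv> real DIM('a)" and "u0 \<equiv> - ln \<delta>"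
  assumes A: "bounded A" "A \<noteq> {}" and \<delta>: "0 < \<delta>"
    and null: "negligible {x. infdist x A = 0}"
    and int: "set_integrable lborel {u0..} (\<lambda>u. exp ((N - Re s) * u) * tube_volume A (exp (- u)))"
  shows "set_integrable lborel (tube A \<delta>) (\<lambda>x. complex_of_real (infdist x A) powr (s - of_real N))"
    and "distance_zeta \<delta> A s = of_real \<delta> powr (s - of_real N) * of_real (tube_volume A \<delta>) +
      (of_real N - s) * (LINT u:{u0..}|lborel. exp ((of_real N - s) * of_real u) * of_real (tube_volume A (exp (- u))))"
proof -
  have mI [measurable]: "(\<lambda>x. infdist x A) \<in> borel_measurable borel"
    by (intro borel_measurable_continuous_onI continuous_intros)
  have mT [measurable]: "tube A t \<in> sets borel" for t using open_tube by (rule borel_open)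
  have vol: "measure lborel (tube A t) = tube_volume A t" for t
    by (simp add: measure_completion)
  have fin: "emeasure lborel (tube A t) < \<infinity>" for t
    using bounded_tube[OF A] by (rule emeasure_bounded_finite)
  define e where "e = (\<lambda>u::real. exp ((of_real N - s) * of_real u))"
  have me [measurable]: "e \<in> borel_measurable borel"
    unfolding e_def by (intro borel_measurable_continuous_onI continuous_intros)
  \<comment> \<open>Integrating over \<open>x\<close> produces the tube volume at radius
    \<open>exp (- u)\<close> times \<open>e u\<close>; integrating over \<open>u\<close> produces,
    after multiplication by \<open>N - s\<close>, the power of the distance. Fubini equates the
    two.\<close>
  define k where "k = (\<lambda>u x. indicat_real {u0..} u *\<^sub>R (indicat_real (tube A (exp (- u))) x *\<^sub>R e u))"
  have ne: "norm (e u) = exp ((N - Re s) * u)" for u by (simp add: e_def)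
  have ind_eq: "indicat_real (tube A (exp (- u))) x = (if infdist x A < exp (- u) then 1 else 0)" for u x
    by (simp add: tube_def)
  have mk: "(\<lambda>p. k (fst p) (snd p)) \<in> borel_measurable (lborel \<Otimes>\<^sub>M lborel)"
    unfolding k_def ind_eq by measurable
  have intx: "integrable lborel (\<lambda>x. indicat_real (tube A t) x *\<^sub>R c)" for t and c :: "'b::{banach,second_countable_topology}"
    using fin[of t] by (intro integrable_scaleR_left integrable_real_indicator) auto
  have LINTx: "(LINT x|lborel. indicat_real (tube A t) x *\<^sub>R c) = tube_volume A t *\<^sub>R c"
    for t and c :: "'b::{banach,second_countable_topology}"
    using fin[of t] vol by (subst integral_scaleR_left) auto
  have norm_k: "norm (k u x) = indicat_real {u0..} u *\<^sub>R (indicat_real (tube A (exp (- u))) x *\<^sub>R norm (e u))" for u x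
    by (simp add: k_def)
  have intk: "integrable (lborel \<Otimes>\<^sub>M lborel) (\<lambda>p. k (fst p) (snd p))"
  proof (rule lborel_pair.Fubini_integrable[OF mk])
    have "(\<lambda>u. LINT x|lborel. norm (k u x)) = (\<lambda>u. indicat_real {u0..} u *\<^sub>R (exp ((N - Re s) * u) * tube_volume A (exp (- u))))"
      unfolding norm_k by (subst integral_scaleR_right, subst LINTx) (simp add: ne mult.commute)
    thus "integrable lborel (\<lambda>u. LINT x|lborel. norm (k (fst (u, x)) (snd (u, x))))"
      using int by (simp add: set_integrable_def)
    show "AE u in lborel. integrable lborel (\<lambda>x. k (fst (u, x)) (snd (u, x)))"
      unfolding k_def fst_conv snd_conv by (intro AE_I2 integrable_scaleR_right intx)
  qed
  hence intk': "integrable (lborel \<Otimes>\<^sub>M lborel) (case_prod k)"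
    by (simp add: case_prod_unfold)
  have "{x. infdist x A = 0} \<in> null_sets lborel"
    using null by (simp add: negligible_iff_null_sets null_sets_completion_iff)
  hence AE0: "AE x in lborel. infdist x A \<noteq> 0"
    using AE_not_in by force
  \<comment> \<open>The \<open>u\<close>-integral runs from \<open>u0\<close> to
    \<open>- ln (infdist x A)\<close>. Its lower endpoint contributes the power of \<delta>, which
    is the origin of the boundary term in the formula.\<close>
  have inner: "(of_real N - s) * (LINT u|lborel. k u x) =
      indicat_real (tube A \<delta>) x *\<^sub>R (of_real (infdist x A) powr (s - of_real N) - of_real \<delta> powr (s - of_real N))"
    if d: "infdist x A \<noteq> 0" for x
  proof (cases "infdist x A < \<delta>")
    case True
    let ?d = "infdist x A"
    have d0: "0 < ?d" using d infdist_nonneg[of x A] by simp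
    have le: "u0 \<le> - ln ?d" using d0 True by (simp add: u0_def)
    have iff: "?d < exp (- u) \<longleftrightarrow> u < - ln ?d" for u
    proof -
      have "?d < exp (- u) \<longleftrightarrow> exp (ln ?d) < exp (- u)" using d0 by simp
      thus ?thesis unfolding exp_less_cancel_iff by auto
    qed
    have "k u x = indicat_real {u0..<- ln ?d} u *\<^sub>R e u" for u
      by (simp add: k_def tube_def iff indicator_def)
    hence "(of_real N - s) * (LINT u|lborel. k u x) = (of_real N - s) * (LINT u:{u0..<- ln ?d}|lborel. e u)"
      by (simp add: set_lebesgue_integral_def)
    also have "\<dots> = e (- ln ?d) - e u0"
      unfolding e_def by (rule exp_interval_integral[OF le])
    also have "e (- ln ?d) = of_real ?d powr (s - of_real N)"
      using d0 by (simp add: e_def powr_def Ln_of_real algebra_simps)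
    also have "e u0 = of_real \<delta> powr (s - of_real N)"
      using \<delta> by (simp add: e_def u0_def powr_def Ln_of_real algebra_simps)
    finally show ?thesis using True by (simp add: tube_def)
  next
    case False
    have "k u x = 0" for u
    proof (cases "u0 \<le> u")
      case True
      hence "exp (- u) \<le> \<delta>"
        using exp_le_cancel_iff[of "- u" "ln \<delta>"] \<delta> by (simp add: u0_def)
      thus ?thesis using False by (simp add: k_def tube_def)
    qed (simp add: k_def)
    thus ?thesis using False by (simp add: tube_def)
  qed
  have i1: "integrable lborel (\<lambda>x. (of_real N - s) * (LINT u|lborel. k u x))"
    using lborel_pair.integrable_snd[OF intk'] by simp
  let ?c = "complex_of_real \<delta> powr (s - of_real N)"
  let ?p = "\<lambda>x. complex_of_real (infdist x A) powr (s - of_real N)"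
  have mp: "?p \<in> borel_measurable borel"
    by measurable
  have AEp: "AE x in lborel. (of_real N - s) * (LINT u|lborel. k u x) + indicat_real (tube A \<delta>) x *\<^sub>R ?c = indicat_real (tube A \<delta>) x *\<^sub>R ?p x"
    using AE0 by eventually_elim (simp add: inner scaleR_diff_right)
  \<comment> \<open>Fubini yields integrability of the inner integral; adding back the boundary
    constant on the tube of finite measure gives integrability of the power itself.\<close>
  have isum: "integrable lborel (\<lambda>x. (of_real N - s) * (LINT u|lborel. k u x) + indicat_real (tube A \<delta>) x *\<^sub>R ?c)"
    by (intro Bochner_Integration.integrable_add i1 intx)
  show intp: "set_integrable lborel (tube A \<delta>) ?p"
    unfolding set_integrable_def
    by (rule integrable_cong_AE_imp[OF isum]) (use mp AEp in \<open>auto elim: AE_mp\<close>)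
  have "distance_zeta \<delta> A s = (LINT x|lborel. indicat_real (tube A \<delta>) x *\<^sub>R ?p x)"
    unfolding distance_zeta_def set_lebesgue_integral_def N_def
    by (subst integral_completion) (use mp in \<open>simp_all add: N_def\<close>)
  also have "\<dots> = (LINT x|lborel. (of_real N - s) * (LINT u|lborel. k u x) + indicat_real (tube A \<delta>) x *\<^sub>R ?c)"
    by (rule integral_cong_AE) (use AEp mp isum in \<open>auto simp: eq_commute\<close>)
  also have "\<dots> = (of_real N - s) * (LINT x|lborel. LINT u|lborel. k u x) + tube_volume A \<delta> *\<^sub>R ?c"
    using i1 intx LINTx by (subst Bochner_Integration.integral_add) auto
  also have "(LINT x|lborel. LINT u|lborel. k u x) = (LINT u|lborel. LINT x|lborel. k u x)"
    by (rule lborel_pair.Fubini_integral[OF intk'])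
  also have "\<dots> = (LINT u:{u0..}|lborel. e u * of_real (tube_volume A (exp (- u))))"
    unfolding k_def set_lebesgue_integral_def
    by (subst integral_scaleR_right, subst LINTx) (simp add: scaleR_conv_of_real mult.commute)
  finally show "distance_zeta \<delta> A s = ?c * of_real (tube_volume A \<delta>) +
      (of_real N - s) * (LINT u:{u0..}|lborel. exp ((of_real N - s) * of_real u) * of_real (tube_volume A (exp (- u))))"
    by (simp add: e_def scaleR_conv_of_real)
qed

section \<open>Minkowski contents\<close>

text \<open>An equality of filters rather than a limit, so that \<open>Limsup\<close> and
  \<open>Liminf\<close> at 0 from the right can be rewritten at infinity.\<close>

lemma filtermap_exp_minus_at_top: "filtermap (\<lambda>u::real. exp (- u)) at_top = at_right 0"
proof (rule filtermap_fun_inverse[where g = "\<lambda>t. - ln t"])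
  show "filterlim (\<lambda>t::real. - ln t) at_top (at_right 0)"
    using ln_at_0 by (simp add: filterlim_uminus_at_top_at_bot filterlim_uminus_at_top)
  have "((\<lambda>u::real. exp (- u)) \<longlongrightarrow> 0) at_top"
    by (rule filterlim_compose[OF exp_at_bot filterlim_uminus_at_bot_at_top])
  thus "filterlim (\<lambda>u::real. exp (- u)) (at_right 0) at_top"
    by (auto simp: filterlim_at)
  show "\<forall>\<^sub>F t in at_right 0. exp (- (- ln t)) = (t::real)"
    by (auto intro!: eventually_at_right_less[THEN eventually_mono])
qed

lemma inj_exp_minus: "inj (\<lambda>u::real. exp (- u))"
  by (auto intro!: injI)

text \<open>\<open>G\<close> is any nonnegative periodic function that is not identically zero, so
  that a positive constant, read as a function of period 1, is an instance.\<close>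

locale periodic_tube_asymptotics =
  fixes A :: "'a::euclidean_space set" and D \<alpha> \<delta> T :: real and G :: "real \<Rightarrow> real" and N :: real
  assumes N: "N = real DIM('a)"
    and A: "bounded A" "A \<noteq> {}" and D: "0 \<le> D" "D < N" and \<alpha>: "0 < \<alpha>" and \<delta>: "0 < \<delta>"
    and T: "0 < T" and per: "\<And>x. G (x + T) = G x" and G0: "\<And>x. 0 \<le> G x" and G_nz: "\<exists>x. G x \<noteq> 0"
    and asymp: "\<exists>R. R \<in> O[at_right 0](\<lambda>t. t powr \<alpha>) \<and>
      (\<forall>\<^sub>F t in at_right 0. tube_volume A t = t powr (N - D) * (G (ln (1 / t)) + R t))"
begin

definition W :: "real \<Rightarrow> real" where
  "W u = exp ((N - D) * u) * tube_volume A (exp (- u))"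

lemma W_bound: "\<exists>C U. \<forall>u\<ge>U. \<bar>W u - G u\<bar> \<le> C * exp (- \<alpha> * u)"
proof -
  obtain R where R: "R \<in> O[at_right 0](\<lambda>t. t powr \<alpha>)"
    "\<forall>\<^sub>F t in at_right 0. tube_volume A t = t powr (N - D) * (G (ln (1 / t)) + R t)"
    using asymp by blast
  obtain C where C: "\<forall>\<^sub>F t in at_right 0. norm (R t) \<le> C * norm (t powr \<alpha>)"
    using R(1) by (elim landau_o.bigE)
  have "\<forall>\<^sub>F t in at_right 0. \<bar>t powr (D - N) * tube_volume A t - G (ln (1 / t))\<bar> \<le> C * t powr \<alpha>"
    using R(2) C eventually_at_right_less[of 0]
  proof eventually_elim
    case (elim t)
    have "t powr (D - N) * tube_volume A t = (t powr (D - N) * t powr (N - D)) * (G (ln (1 / t)) + R t)"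
      by (simp only: elim(1) mult.assoc)
    also have "t powr (D - N) * t powr (N - D) = 1"
      using elim(3) by (simp add: powr_add[symmetric])
    finally show ?case using elim(2) by simp
  qed
  hence "\<forall>\<^sub>F u in at_top. \<bar>exp (- u) powr (D - N) * tube_volume A (exp (- u)) - G (ln (1 / exp (- u)))\<bar> \<le> C * exp (- u) powr \<alpha>"
    by (simp only: eventually_filtermap flip: filtermap_exp_minus_at_top)
  hence "\<forall>\<^sub>F u in at_top. \<bar>W u - G u\<bar> \<le> C * exp (- \<alpha> * u)"
    by eventually_elim (simp add: W_def powr_def ln_div algebra_simps)
  thus ?thesis by (auto simp: eventually_at_top_linorder)
qed

lemma continuous_W: "continuous_on S W"
proof -
  have "continuous_on UNIV (\<lambda>u. tube_volume A (exp (- u)))"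
    by (rule continuous_on_compose2[OF continuous_on_tube_volume[OF A]]) (auto intro!: continuous_intros)
  hence "continuous_on UNIV W"
    unfolding W_def by (intro continuous_intros)
  thus ?thesis using continuous_on_subset by blast
qed

text \<open>Translation by \<open>n * T\<close> leaves \<open>G\<close> fixed and pushes the error
  to at most C exp(- \<alpha> (a + n T)), uniformly on the half-line.\<close>

lemma W_uniform_limit: "uniform_limit {a..} (\<lambda>n x. W (x + of_nat n * T)) G sequentially"
  unfolding uniform_limit_iff
proof (intro allI impI)
  fix e :: real assume e: "0 < e"
  obtain C U where CU: "\<And>u. u \<ge> U \<Longrightarrow> \<bar>W u - G u\<bar> \<le> C * exp (- \<alpha> * u)" using W_bound by blast
  have C: "0 \<le> C"
    using order_trans[OF abs_ge_zero CU[OF order_refl]] by (simp add: zero_le_mult_iff)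
  have top: "filterlim (\<lambda>n. a + real n * T) at_top sequentially"
    by (intro filterlim_tendsto_add_at_top[OF tendsto_const] filterlim_at_top_mult_tendsto_pos[OF tendsto_const T]
        filterlim_real_sequentially)
  have "((\<lambda>u. C * exp (- (\<alpha> * u))) \<longlongrightarrow> C * 0) at_top"
  proof (intro tendsto_intros filterlim_compose[OF exp_at_bot])
    show "filterlim (\<lambda>u. - (\<alpha> * u)) at_bot at_top"
      unfolding filterlim_uminus_at_top[symmetric]
      using \<alpha> by (intro filterlim_tendsto_pos_mult_at_top[OF tendsto_const] filterlim_ident)
  qed
  from filterlim_compose[OF this top]
  have "\<forall>\<^sub>F n in sequentially. C * exp (- (\<alpha> * (a + real n * T))) < e"
    using order_tendstoD(2) e by force
  moreover have "\<forall>\<^sub>F n in sequentially. U \<le> a + real n * T"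
    using top by (simp add: filterlim_at_top)
  ultimately show "\<forall>\<^sub>F n in sequentially. \<forall>x\<in>{a..}. dist (W (x + real n * T)) (G x) < e"
  proof eventually_elim
    case (elim n)
    show ?case
    proof
      fix x assume x: "x \<in> {a..}"
      have "G (x + real n * T) = G x" using periodic_of_int[of G T x "int n"] per by simp
      hence "dist (W (x + real n * T)) (G x) \<le> C * exp (- \<alpha> * (x + real n * T))"
        using CU[of "x + real n * T"] x elim(2) by (simp add: dist_real_def)
      also have "\<dots> \<le> C * exp (- (\<alpha> * (a + real n * T)))"
        using C x \<alpha> by (intro mult_left_mono) auto
      finally show "dist (W (x + real n * T)) (G x) < e" using elim(1) by simp
    qed
  qed
qed

lemma W_tendsto: "(\<lambda>n. W (x + of_nat n * T)) \<longlonglongrightarrow> G x"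
  using tendsto_uniform_limitI[OF W_uniform_limit[of x], of x] by simp

lemma continuous_G: "continuous_on UNIV G"
proof -
  have "isCont G x" for x
  proof -
    have "continuous_on {x - 1..} G"
    proof (rule uniform_limit_theorem[OF _ W_uniform_limit])
      have "continuous_on {x - 1..} (\<lambda>y. W (y + of_nat n * T))" for n
        by (rule continuous_on_compose2[OF continuous_W[of UNIV]]) (auto intro!: continuous_intros)
      thus "\<forall>\<^sub>F n in sequentially. continuous_on {x - 1..} (\<lambda>y. W (y + of_nat n * T))" by simp
    qed simp
    thus ?thesis by (rule continuous_on_interior) simp
  qed
  thus ?thesis by (simp add: continuous_on_eq_continuous_at)
qed

text \<open>Since \<open>tube_volume A\<close> is monotone, \<open>exp (- (N - D) * x) * G x\<close> is antitone; so a zero of \<open>G\<close>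
  would propagate to all larger arguments and, by periodicity, everywhere.\<close>

lemma G_growth:
  assumes "x \<le> y"
  shows "G y \<le> exp ((N - D) * (y - x)) * G x"
proof (rule LIMSEQ_le[OF W_tendsto tendsto_mult_left[OF W_tendsto]], intro exI allI impI)
  fix n :: nat
  have "tube_volume A (exp (- (y + of_nat n * T))) \<le> tube_volume A (exp (- (x + of_nat n * T)))"
    using lmeasurable_tube[OF A] assms by (intro measure_mono_fmeasurable tube_mono) (auto intro: fmeasurableD)
  hence "W (y + of_nat n * T) \<le> exp ((N - D) * (y + of_nat n * T)) * tube_volume A (exp (- (x + of_nat n * T)))"
    unfolding W_def by (intro mult_left_mono) auto
  also have "\<dots> = exp ((N - D) * (y - x)) * W (x + of_nat n * T)"
  proof -
    have "exp ((N - D) * (y + of_nat n * T)) = exp ((N - D) * (y - x)) * exp ((N - D) * (x + of_nat n * T))"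
      by (simp add: exp_add[symmetric] algebra_simps)
    thus ?thesis unfolding W_def by (simp only: mult.assoc)
  qed
  finally show "W (y + of_nat n * T) \<le> exp ((N - D) * (y - x)) * W (x + of_nat n * T)" .
qed

lemma G_pos: "0 < G x"
proof (rule ccontr)
  assume "\<not> 0 < G x"
  hence x: "G x = 0" using G0[of x] by simp
  have "G y = 0" for y
  proof -
    have "x \<le> y + of_int \<lceil>(x - y) / T\<rceil> * T"
      using T mult_right_mono[OF le_of_int_ceiling[of "(x - y) / T"], of T] by simp
    from G_growth[OF this] have "G y \<le> 0"
      using x periodic_of_int[of G T y] per by simp
    thus ?thesis using G0[of y] by simp
  qed
  thus False using G_nz by simp
qed

lemma G_attains:
  obtains a b where "\<And>x. G a \<le> G x" "\<And>x. G x \<le> G b"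
  using periodic_attains[of G T, OF continuous_G per T] by metis

lemma W_minus_G: "((\<lambda>u. W u - G u) \<longlongrightarrow> 0) at_top"
proof -
  obtain C U where CU: "\<And>u. u \<ge> U \<Longrightarrow> \<bar>W u - G u\<bar> \<le> C * exp (- \<alpha> * u)" using W_bound by blast
  have "((\<lambda>u. C * exp (- \<alpha> * u)) \<longlongrightarrow> C * 0) at_top"
  proof (intro tendsto_intros filterlim_compose[OF exp_at_bot])
    show "filterlim (\<lambda>u. - \<alpha> * u) at_bot at_top"
      using \<alpha> by (intro filterlim_tendsto_neg_mult_at_bot[OF tendsto_const] filterlim_ident) auto
  qed
  hence "((\<lambda>u. C * exp (- \<alpha> * u)) \<longlongrightarrow> 0) at_top" by simp
  moreover have "\<forall>\<^sub>F u in at_top. norm (W u - G u) \<le> C * exp (- \<alpha> * u)"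
    using CU by (intro eventually_at_top_linorderI[of U]) simp
  ultimately show ?thesis by (rule Lim_null_comparison[rotated])
qed

lemma W_eventually_less: "\<forall>\<^sub>F u in at_top. W u < c" if "\<And>x. G x \<le> b" "b < c"
proof -
  have "\<forall>\<^sub>F u in at_top. W u - G u < c - b"
    using order_tendstoD(2)[OF W_minus_G, of "c - b"] that(2) by simp
  thus ?thesis by eventually_elim (use that(1) in \<open>smt (verit)\<close>)
qed

lemma W_eventually_greater: "\<forall>\<^sub>F u in at_top. c < W u" if "\<And>x. a \<le> G x" "c < a"
proof -
  have "\<forall>\<^sub>F u in at_top. c - a < W u - G u"
    using order_tendstoD(1)[OF W_minus_G, of "c - a"] that(2) by simp
  thus ?thesis by eventually_elim (use that(1) in \<open>smt (verit)\<close>)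
qed

lemma upper_content_eq: "upper_minkowski_content r A = Limsup at_top (\<lambda>u. ereal (exp ((r - D) * - u) * W u))"
  and lower_content_eq: "lower_minkowski_content r A = Liminf at_top (\<lambda>u. ereal (exp ((r - D) * - u) * W u))"
proof -
  have eq: "tube_volume A (exp (- u)) / exp (- u) powr (real DIM('a) - r) = exp ((r - D) * - u) * W u" for u
  proof -
    have "exp (- u) powr (N - r) = exp (- ((N - r) * u))" by (simp add: powr_def)
    moreover have "exp ((r - D) * - u) * exp ((N - D) * u) = exp ((N - r) * u)"
      by (simp add: exp_add[symmetric] algebra_simps)
    ultimately show ?thesis
      unfolding W_def N[symmetric] mult.assoc[symmetric] by (simp add: exp_minus divide_inverse)
  qed
  show "upper_minkowski_content r A = Limsup at_top (\<lambda>u. ereal (exp ((r - D) * - u) * W u))"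
    unfolding upper_minkowski_content_def
    by (subst filtermap_exp_minus_at_top[symmetric], subst Limsup_filtermap_eq[OF inj_exp_minus]) (simp add: eq)
  show "lower_minkowski_content r A = Liminf at_top (\<lambda>u. ereal (exp ((r - D) * - u) * W u))"
    unfolding lower_minkowski_content_def
    by (subst filtermap_exp_minus_at_top[symmetric], subst Liminf_filtermap_eq[OF inj_exp_minus]) (simp add: eq)
qed

lemma shift_at_top: "filterlim (\<lambda>n. x + real n * T) at_top sequentially"
  by (intro filterlim_tendsto_add_at_top[OF tendsto_const] filterlim_at_top_mult_tendsto_pos[OF tendsto_const T]
      filterlim_real_sequentially)

text \<open>The upper bound holds because \<open>W - G\<close> tends to 0. The lower bound is seen
  along the points \<open>b + n * T\<close>, where \<open>W\<close> tends to
  \<open>G b\<close>.\<close>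

lemma upper_content:
  assumes b: "\<And>x. G x \<le> G b"
  shows "upper_minkowski_content D A = ereal (G b)"
proof (rule antisym)
  show "upper_minkowski_content D A \<le> ereal (G b)"
    unfolding upper_content_eq Limsup_le_iff
  proof (intro allI impI)
    fix y assume "ereal (G b) < y"
    then obtain z where z: "ereal (G b) < ereal z" "ereal z < y" using ereal_dense2 by blast
    have "\<forall>\<^sub>F u in at_top. W u < z" using W_eventually_less[OF b] z(1) by simp
    thus "\<forall>\<^sub>F u in at_top. ereal (exp ((D - D) * - u) * W u) < y"
      by eventually_elim (use z(2) in \<open>auto intro: less_trans[of "ereal _" "ereal z"]\<close>)
  qed
  show "ereal (G b) \<le> upper_minkowski_content D A"
  proof (rule ccontr)
    assume "\<not> ?thesis"
    then obtain z where z: "upper_minkowski_content D A < ereal z" "ereal z < ereal (G b)"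
      using ereal_dense2 by (metis linorder_not_le)
    have "\<forall>\<^sub>F u in at_top. ereal (exp ((D - D) * - u) * W u) < ereal z"
      using z(1) unfolding upper_content_eq by (rule Limsup_lessD)
    hence "\<forall>\<^sub>F u in at_top. W u < z" by simp
    hence "\<forall>\<^sub>F n in sequentially. W (b + real n * T) < z"
      using shift_at_top[of b] by (rule eventually_compose_filterlim)
    hence "G b \<le> z"
      by (intro tendsto_upperbound[OF W_tendsto]) (auto elim: eventually_mono)
    thus False using z(2) by simp
  qed
qed

lemma lower_content:
  assumes a: "\<And>x. G a \<le> G x"
  shows "lower_minkowski_content D A = ereal (G a)"
proof (rule antisym)
  show "ereal (G a) \<le> lower_minkowski_content D A"
    unfolding lower_content_eq le_Liminf_iff
  proof (intro allI impI)
    fix y assume "y < ereal (G a)"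
    then obtain z where z: "ereal z < ereal (G a)" "y < ereal z" using ereal_dense2 by blast
    have "\<forall>\<^sub>F u in at_top. z < W u" using W_eventually_greater[OF a] z(1) by simp
    thus "\<forall>\<^sub>F u in at_top. y < ereal (exp ((D - D) * - u) * W u)"
      by eventually_elim (use z(2) in \<open>auto intro: less_trans[of _ "ereal z"]\<close>)
  qed
  show "lower_minkowski_content D A \<le> ereal (G a)"
  proof (rule ccontr)
    assume "\<not> ?thesis"
    then obtain z where z: "ereal z < lower_minkowski_content D A" "ereal (G a) < ereal z"
      using ereal_dense2 by (metis linorder_not_le)
    have "\<forall>\<^sub>F u in at_top. ereal z < ereal (exp ((D - D) * - u) * W u)"
      using z(1) unfolding lower_content_eq by (rule less_LiminfD)
    hence "\<forall>\<^sub>F u in at_top. z < W u" by simp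
    hence "\<forall>\<^sub>F n in sequentially. z < W (a + real n * T)"
      using shift_at_top[of a] by (rule eventually_compose_filterlim)
    hence "z \<le> G a"
      by (intro tendsto_lowerbound[OF W_tendsto]) (auto elim: eventually_mono)
    thus False using z(2) by simp
  qed
qed

section \<open>Minkowski dimension, nondegeneracy and measurability\<close>

lemma W_eventually_bounded: "\<exists>c C. 0 < c \<and> (\<forall>\<^sub>F u in at_top. c < W u \<and> W u < C)"
proof -
  obtain a b where ab: "\<And>x. G a \<le> G x" "\<And>x. G x \<le> G b" using G_attains by blast
  \<comment> \<open>The lower bound is positive because \<open>G\<close> is positive at the point
    where its minimum is attained.\<close>
  have "\<forall>\<^sub>F u in at_top. G a / 2 < W u \<and> W u < G b + 1"
    using W_eventually_greater[of "G a" "G a / 2"] W_eventually_less[of "G b" "G b + 1"] ab G_pos[of a]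
    by (intro eventually_conj) auto
  thus ?thesis using G_pos[of a] by (intro exI[of _ "G a / 2"] exI[of _ "G b + 1"]) simp
qed

lemma scaled_W_at_top:
  assumes "r < D"
  shows "filterlim (\<lambda>u. exp ((r - D) * - u) * W u) at_top at_top"
proof -
  obtain c C where c: "0 < c" "\<forall>\<^sub>F u in at_top. c < W u \<and> W u < C" using W_eventually_bounded by blast
  have lin: "filterlim (\<lambda>u. (r - D) * - u) at_top at_top"
    using assms filterlim_tendsto_pos_mult_at_top[OF tendsto_const _ filterlim_ident, of "D - r"]
    by (simp add: algebra_simps)
  have "filterlim (\<lambda>u. exp ((r - D) * - u) * c) at_top at_top"
    by (rule filterlim_at_top_mult_tendsto_pos[OF tendsto_const c(1) filterlim_compose[OF exp_at_top lin]])
  moreover have "\<forall>\<^sub>F u in at_top. exp ((r - D) * - u) * c \<le> exp ((r - D) * - u) * W u"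
    using c(2) by eventually_elim simp
  ultimately show ?thesis by (rule filterlim_at_top_mono)
qed

lemma scaled_W_tendsto_0:
  assumes "D < r"
  shows "((\<lambda>u. exp ((r - D) * - u) * W u) \<longlongrightarrow> 0) at_top"
proof -
  obtain c C where c: "0 < c" "\<forall>\<^sub>F u in at_top. c < W u \<and> W u < C" using W_eventually_bounded by blast
  have lin: "filterlim (\<lambda>u. (r - D) * - u) at_bot at_top"
    using assms filterlim_tendsto_neg_mult_at_bot[OF tendsto_const _ filterlim_ident, of "D - r"]
    by (simp add: algebra_simps)
  have "((\<lambda>u. C * exp ((r - D) * - u)) \<longlongrightarrow> C * 0) at_top"
    by (intro tendsto_intros filterlim_compose[OF exp_at_bot lin])
  hence "((\<lambda>u. C * exp ((r - D) * - u)) \<longlongrightarrow> 0) at_top" by simp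
  moreover have "\<forall>\<^sub>F u in at_top. norm (exp ((r - D) * - u) * W u) \<le> C * exp ((r - D) * - u)"
    using c(2) by eventually_elim (use c(1) in \<open>simp add: abs_mult\<close>)
  ultimately show ?thesis by (rule Lim_null_comparison[rotated])
qed

lemma content_above: "upper_minkowski_content r A = 0" "lower_minkowski_content r A = 0" if "D < r"
proof -
  have lim: "((\<lambda>u. ereal (exp ((r - D) * - u) * W u)) \<longlongrightarrow> ereal 0) at_top"
    using scaled_W_tendsto_0[OF that] by (intro tendsto_intros)
  show "upper_minkowski_content r A = 0" "lower_minkowski_content r A = 0"
    unfolding upper_content_eq lower_content_eq
    using lim_imp_Limsup[OF _ lim] lim_imp_Liminf[OF _ lim] by (auto simp: zero_ereal_def)
qed

lemma content_below: "upper_minkowski_content r A = \<infinity>" "lower_minkowski_content r A = \<infinity>" if "r < D"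
proof -
  have lim: "((\<lambda>u. ereal (exp ((r - D) * - u) * W u)) \<longlongrightarrow> \<infinity>) at_top"
    using scaled_W_at_top[OF that] by (simp add: tendsto_PInfty_eq_at_top)
  show "upper_minkowski_content r A = \<infinity>" "lower_minkowski_content r A = \<infinity>"
    unfolding upper_content_eq lower_content_eq
    using lim_imp_Limsup[OF _ lim] lim_imp_Liminf[OF _ lim] by auto
qed

text \<open>At \<open>D\<close> itself the contents are extreme values of \<open>G\<close>, hence
  positive; above \<open>D\<close> they are 0 and below it infinite.\<close>

lemma content_zero_iff: "upper_minkowski_content r A = 0 \<longleftrightarrow> D < r" "lower_minkowski_content r A = 0 \<longleftrightarrow> D < r"
proof -
  obtain a b where ab: "\<And>x. G a \<le> G x" "\<And>x. G x \<le> G b" using G_attains by blast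
  have "ereal (G a) \<noteq> 0" "ereal (G b) \<noteq> 0" using G_pos[of a] G_pos[of b] by auto
  thus "upper_minkowski_content r A = 0 \<longleftrightarrow> D < r" "lower_minkowski_content r A = 0 \<longleftrightarrow> D < r"
    using content_above[of r] content_below[of r] upper_content[of b] lower_content[of a] ab
    by (cases r D rule: linorder_cases; force)+
qed

lemma minkowski_dim: "has_minkowski_dim A D"
proof -
  have "{r. 0 < r \<and> D < r} = {D<..}" using D by auto
  thus ?thesis
    unfolding has_minkowski_dim_def upper_minkowski_dim_def lower_minkowski_dim_def content_zero_iff
    by simp
qed

lemma minkowski_nondegenerate: "minkowski_nondegenerate A"
proof -
  obtain a b where ab: "\<And>x. G a \<le> G x" "\<And>x. G x \<le> G b" using G_attains by blast
  show ?thesis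
    unfolding minkowski_nondegenerate_def
    using ab(1)[of b] G_pos[of a] D upper_content[of b] lower_content[of a] ab
    by (intro exI[of _ D]) auto
qed

text \<open>The definition quantifies the dimension existentially. Since the contents are 0 or
  infinite away from \<open>D\<close>, the witness must be \<open>D\<close>, where they are the
  minimum and the maximum of \<open>G\<close>.\<close>

lemma minkowski_measurable_iff: "minkowski_measurable A \<longleftrightarrow> (\<forall>x y. G x = G y)"
proof -
  obtain a b where ab: "\<And>x. G a \<le> G x" "\<And>x. G x \<le> G b" using G_attains by blast
  note cont = upper_content[of b, OF ab(2)] lower_content[of a, OF ab(1)]
  have "minkowski_measurable A \<longleftrightarrow> G a = G b"
  proof
    assume "minkowski_measurable A"
    then obtain r where r: "0 < lower_minkowski_content r A"
      "lower_minkowski_content r A = upper_minkowski_content r A" "upper_minkowski_content r A < \<infinity>"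
      unfolding minkowski_measurable_def by blast
    have "r = D" using r content_above[of r] content_below[of r] by (cases r D rule: linorder_cases) auto
    thus "G a = G b" using r(2) cont by simp
  next
    assume "G a = G b"
    thus "minkowski_measurable A"
      unfolding minkowski_measurable_def using cont D G_pos[of a] by (intro exI[of _ D]) auto
  qed
  also have "\<dots> \<longleftrightarrow> (\<forall>x y. G x = G y)"
    using ab by (metis order_antisym)
  finally show ?thesis .
qed

end

section \<open>The meromorphic continuation\<close>

context periodic_tube_asymptotics
begin

text \<open>The closure of \<open>A\<close> lies in every tube, and the tube volumes tend to 0
  because \<open>D < N\<close>.\<close>

lemma negligible_infdist_0: "negligible {x. infdist x A = 0}"
proof -
  have meas: "{x. infdist x A = 0} \<in> lmeasurable"
  proof -
    have "{x. infdist x A = 0} = closure A"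
      using in_closure_iff_infdist_zero[OF A(2)] by auto
    thus ?thesis using A(1) by (simp add: lmeasurable_compact)
  qed
  have "measure lebesgue {x. infdist x A = 0} \<le> 0"
  proof (rule tendsto_lowerbound[OF scaled_W_tendsto_0[of N]])
    show "D < N" by (rule D(2))
    show "\<forall>\<^sub>F u in at_top. measure lebesgue {x. infdist x A = 0} \<le> exp ((N - D) * - u) * W u"
    proof (rule always_eventually, rule allI)
      fix u
      have "exp ((N - D) * - u) * W u = tube_volume A (exp (- u))"
        by (simp add: W_def exp_minus flip: mult.assoc)
      moreover have "{x. infdist x A = 0} \<subseteq> tube A (exp (- u))" by (auto simp: tube_def)
      ultimately show "measure lebesgue {x. infdist x A = 0} \<le> exp ((N - D) * - u) * W u"
        using meas lmeasurable_tube[OF A] by (simp add: measure_mono_fmeasurable fmeasurableD)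
    qed
  qed simp
  thus ?thesis using meas measure_nonneg[of lebesgue "{x. infdist x A = 0}"]
    by (simp add: negligible_iff_measure)
qed

definition u0 :: real where "u0 = - ln \<delta>"

definition rho :: "real \<Rightarrow> real" where "rho u = W u - G u"

lemma continuous_rho: "continuous_on UNIV rho"
  unfolding rho_def by (intro continuous_intros continuous_W continuous_G)

text \<open>The asymptotics control \<open>rho\<close> only for large arguments; on the remaining
  compact interval the continuous function \<open>rho u * exp (\<alpha> * u)\<close> is bounded, and
  the larger constant serves everywhere.\<close>

lemma rho_bound: "\<exists>C. \<forall>u\<ge>u0. \<bar>rho u\<bar> \<le> C * exp (- \<alpha> * u)"
proof -
  obtain C U where CU: "\<And>u. u \<ge> U \<Longrightarrow> \<bar>W u - G u\<bar> \<le> C * exp (- \<alpha> * u)" using W_bound by blast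
  have "compact ((\<lambda>u. rho u * exp (\<alpha> * u)) ` {u0..U})"
    by (intro compact_continuous_image continuous_intros continuous_on_subset[OF continuous_rho]) auto
  from compact_imp_bounded[OF this]
  obtain B where "\<forall>y\<in>(\<lambda>u. rho u * exp (\<alpha> * u)) ` {u0..U}. norm y \<le> B"
    unfolding bounded_iff by blast
  hence B: "\<bar>rho u * exp (\<alpha> * u)\<bar> \<le> B" if "u \<in> {u0..U}" for u
    using that unfolding real_norm_def by blast
  have "\<bar>rho u\<bar> \<le> max B C * exp (- \<alpha> * u)" if u: "u0 \<le> u" for u
  proof (cases "U \<le> u")
    case True
    have "\<bar>rho u\<bar> \<le> C * exp (- \<alpha> * u)" using CU[OF True] by (simp add: rho_def)
    also have "\<dots> \<le> max B C * exp (- \<alpha> * u)" by (intro mult_right_mono) auto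
    finally show ?thesis .
  next
    case False
    have "\<bar>rho u\<bar> = \<bar>rho u * exp (\<alpha> * u)\<bar> * exp (- \<alpha> * u)"
      by (simp add: abs_mult exp_minus)
    also have "\<dots> \<le> max B C * exp (- \<alpha> * u)"
      using B[of u] False u by (intro mult_right_mono) auto
    finally show ?thesis .
  qed
  thus ?thesis by blast
qed

definition laplace_rho :: "complex \<Rightarrow> complex" where
  "laplace_rho z = (LINT u:{u0..}|lborel. exp (- z * of_real u) * of_real (rho u))"

text \<open>For Re z > 0 this is \<open>1 - exp (- T * z)\<close> times the Laplace transform of
  \<open>G\<close>; unlike that transform it is entire.\<close>

definition period_integral :: "complex \<Rightarrow> complex" where
  "period_integral z = integral {u0..u0 + T} (\<lambda>u. exp (- z * of_real u) * of_real (G u))"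

lemma laplace_rho_holomorphic: "laplace_rho holomorphic_on {z. - \<alpha> < Re z}"
proof -
  obtain C where C: "\<And>u. u0 \<le> u \<Longrightarrow> \<bar>rho u\<bar> \<le> C * exp (- \<alpha> * u)" using rho_bound by blast
  show ?thesis
    using laplace_holomorphic[OF continuous_rho C] unfolding laplace_rho_def by simp
qed

lemma period_integral_holomorphic: "period_integral holomorphic_on UNIV"
  unfolding period_integral_def by (rule laplace_finite_holomorphic[OF continuous_G])

lemma laplace_W:
  assumes z: "0 < Re z"
  shows "set_integrable lborel {u0..} (\<lambda>u. exp (- z * of_real u) * complex_of_real (W u))"
    and "(LINT u:{u0..}|lborel. exp (- z * of_real u) * complex_of_real (W u)) * (1 - exp (- of_real T * z)) =
      period_integral z + (1 - exp (- of_real T * z)) * laplace_rho z"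
proof -
  obtain C where C: "\<And>u. u0 \<le> u \<Longrightarrow> \<bar>rho u\<bar> \<le> C * exp (- \<alpha> * u)" using rho_bound by blast
  have iG: "set_integrable lborel {u0..} (\<lambda>u. exp (- z * of_real u) * complex_of_real (G u))"
    and LG: "(LINT u:{u0..}|lborel. exp (- z * of_real u) * complex_of_real (G u)) * (1 - exp (- of_real T * z)) = period_integral z"
    unfolding period_integral_def using laplace_periodic[OF continuous_G per T z] by blast+
  have ir: "set_integrable lborel {u0..} (\<lambda>u. exp (- z * of_real u) * complex_of_real (rho u))"
    using laplace_integrable[OF continuous_rho C] z \<alpha> by simp
  have eq: "exp (- z * of_real u) * complex_of_real (W u) =
      exp (- z * of_real u) * complex_of_real (G u) + exp (- z * of_real u) * complex_of_real (rho u)" for u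
    by (simp add: rho_def algebra_simps)
  show "set_integrable lborel {u0..} (\<lambda>u. exp (- z * of_real u) * complex_of_real (W u))"
    unfolding eq by (rule set_integral_add(1)[OF iG ir])
  show "(LINT u:{u0..}|lborel. exp (- z * of_real u) * complex_of_real (W u)) * (1 - exp (- of_real T * z)) =
      period_integral z + (1 - exp (- of_real T * z)) * laplace_rho z"
    unfolding eq set_integral_add(2)[OF iG ir] distrib_right LG laplace_rho_def by (simp add: mult.commute)
qed

lemma zeta_formula:
  assumes s: "D < Re s"
  shows "set_integrable lborel (tube A \<delta>) (\<lambda>x. complex_of_real (infdist x A) powr (s - of_real N))"
    and "distance_zeta \<delta> A s = of_real \<delta> powr (s - of_real N) * of_real (tube_volume A \<delta>) +
      (of_real N - s) * (LINT u:{u0..}|lborel. exp (- (s - of_real D) * of_real u) * of_real (W u))"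
proof -
  have eq: "exp ((of_real N - s) * of_real u) * complex_of_real (tube_volume A (exp (- u))) =
      exp (- (s - of_real D) * of_real u) * of_real (W u)" for u
  proof -
    have "exp ((of_real N - s) * of_real u) = exp (- (s - of_real D) * of_real u) * exp ((of_real N - of_real D) * of_real u)"
      by (simp add: exp_add[symmetric] algebra_simps)
    moreover have "complex_of_real (W u) = exp ((of_real N - of_real D) * of_real u) * of_real (tube_volume A (exp (- u)))"
      by (simp add: W_def flip: exp_of_real)
    ultimately show ?thesis by simp
  qed
  \<comment> \<open>The norm of the complex Laplace integrand is exactly the real integrand required
    by the layer cake formula.\<close>
  have "set_integrable lborel {u0..} (\<lambda>u. norm (exp (- (s - of_real D) * of_real u) * complex_of_real (W u)))"
    using laplace_W(1)[of "s - of_real D"] s by (intro set_integrable_norm) auto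
  also have "(\<lambda>u. norm (exp (- (s - of_real D) * of_real u) * complex_of_real (W u))) =
      (\<lambda>u. exp ((N - Re s) * u) * tube_volume A (exp (- u)))"
    unfolding eq[symmetric] by (simp add: norm_mult)
  finally have int: "set_integrable lborel {u0..} (\<lambda>u. exp ((N - Re s) * u) * tube_volume A (exp (- u)))" .
  note * = distance_zeta_layer_cake[OF A \<delta> negligible_infdist_0 int[unfolded N u0_def], folded N u0_def]
  show "set_integrable lborel (tube A \<delta>) (\<lambda>x. complex_of_real (infdist x A) powr (s - of_real N))"
    by (rule *(1))
  show "distance_zeta \<delta> A s = of_real \<delta> powr (s - of_real N) * of_real (tube_volume A \<delta>) +
      (of_real N - s) * (LINT u:{u0..}|lborel. exp (- (s - of_real D) * of_real u) * of_real (W u))"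
    using *(2) unfolding eq .
qed

section \<open>The abscissa of convergence\<close>

lemma abscissa_member:
  assumes \<sigma>: "D < \<sigma>" "\<sigma> < N"
  shows "(\<integral>\<^sup>+x\<in>tube A \<delta>. dist_power (infdist x A) (\<sigma> - real DIM('a)) \<partial>lebesgue) < \<infinity>"
proof -
  let ?f = "\<lambda>x. indicat_real (tube A \<delta>) x *\<^sub>R (complex_of_real (infdist x A) powr (of_real \<sigma> - of_real N))"
  have "integrable lborel ?f"
    using zeta_formula(1)[of "of_real \<sigma>"] \<sigma> by (simp add: set_integrable_def)
  hence "integrable lebesgue ?f"
    by (subst integrable_completion) auto
  hence "(\<integral>\<^sup>+x. ennreal (norm (?f x)) \<partial>lebesgue) < \<infinity>"
    by (simp add: integrable_iff_bounded)
  \<comment> \<open>At distance 0 the two sides disagree, \<open>powr\<close> being 0 and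
    \<open>dist_power\<close> infinite, but those points form a null set.\<close>
  moreover have "AE x in lebesgue. ennreal (norm (?f x)) =
      dist_power (infdist x A) (\<sigma> - real DIM('a)) * indicator (tube A \<delta>) x"
  proof -
    have "AE x in lebesgue. x \<notin> {x. infdist x A = 0}"
      using negligible_infdist_0 by (intro AE_not_in) (simp add: negligible_iff_null_sets)
    thus ?thesis
    proof eventually_elim
      case (elim x)
      hence "0 < infdist x A" using infdist_nonneg[of x A] by auto
      hence "norm (complex_of_real (infdist x A) powr of_real (\<sigma> - N)) = infdist x A powr (\<sigma> - N)"
        by (subst norm_powr_real_powr) auto
      thus ?case
        using elim by (auto simp: dist_power_def N indicator_def)
    qed
  qed
  ultimately show ?thesis by (simp cong: nn_integral_cong_AE)
qed

text \<open>A Chebyshev estimate: for \<sigma> < D the integrand is at least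
  \<open>t powr (\<sigma> - N)\<close> on the tube of radius \<open>t\<close>, so a finite integral
  would bound \<open>t powr (\<sigma> - N) * tube_volume A t\<close> for all small \<open>t\<close>.
  In the variable \<open>u\<close> this quantity is exp((D - \<sigma>) u) W(u), which tends to
  infinity.\<close>

lemma abscissa_lower:
  assumes fin: "(\<integral>\<^sup>+x\<in>tube A \<delta>. dist_power (infdist x A) (\<sigma> - real DIM('a)) \<partial>lebesgue) < \<infinity>"
  shows "D \<le> \<sigma>"
proof (rule ccontr)
  assume "\<not> D \<le> \<sigma>"
  hence \<sigma>: "\<sigma> < D" by simp
  define I where "I = (\<integral>\<^sup>+x\<in>tube A \<delta>. dist_power (infdist x A) (\<sigma> - N) \<partial>lebesgue)"
  have I: "I < \<infinity>" using fin by (simp add: I_def N)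
  have le: "exp ((\<sigma> - D) * - u) * W u \<le> enn2real I" if u: "u0 \<le> u" for u
  proof -
    let ?t = "exp (- u)"
    have t: "?t \<le> \<delta>" using exp_le_cancel_iff[of "- u" "ln \<delta>"] u \<delta> by (simp add: u0_def)
    have "ennreal (?t powr (\<sigma> - N)) * emeasure lebesgue (tube A ?t) =
        (\<integral>\<^sup>+x. ennreal (?t powr (\<sigma> - N)) * indicator (tube A ?t) x \<partial>lebesgue)"
      using lmeasurable_tube[OF A, of ?t] by (intro nn_integral_cmult_indicator[symmetric]) (auto intro: fmeasurableD)
    also have "\<dots> \<le> I"
      unfolding I_def
    proof (rule nn_integral_mono)
      fix x
      have "ennreal (?t powr (\<sigma> - N)) \<le> dist_power (infdist x A) (\<sigma> - N)" if x: "x \<in> tube A ?t"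
      proof (cases "infdist x A = 0")
        \<comment> \<open>The pointwise inequality at distance 0 relies on the infinite value of
          \<open>dist_power\<close>; the exponent is negative since \<sigma> < D < N.\<close>
        case True
        thus ?thesis using \<sigma> D by (simp add: dist_power_def)
      next
        case False
        hence "0 < infdist x A" using infdist_nonneg[of x A] by simp
        hence "?t powr (\<sigma> - N) \<le> infdist x A powr (\<sigma> - N)"
          using x \<sigma> D by (intro powr_mono2') (auto simp: tube_def)
        thus ?thesis using False by (simp add: dist_power_def ennreal_leI)
      qed
      thus "ennreal (?t powr (\<sigma> - N)) * indicator (tube A ?t) x \<le> dist_power (infdist x A) (\<sigma> - N) * indicator (tube A \<delta>) x"
        using tube_mono[OF t, of A] by (auto simp: indicator_def)
    qed
    finally have "ennreal (?t powr (\<sigma> - N)) * emeasure lebesgue (tube A ?t) \<le> I" .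
    moreover have "emeasure lebesgue (tube A ?t) = ennreal (tube_volume A ?t)"
      using lmeasurable_tube[OF A, of ?t] by (simp add: emeasure_eq_measure2)
    ultimately have "ennreal (?t powr (\<sigma> - N) * tube_volume A ?t) \<le> I"
      by (simp add: ennreal_mult)
    hence "?t powr (\<sigma> - N) * tube_volume A ?t \<le> enn2real I"
      using I by (metis enn2real_ennreal enn2real_mono measure_nonneg mult_nonneg_nonneg powr_ge_zero infinity_ennreal_def)
    moreover have "exp ((\<sigma> - D) * - u) * exp ((N - D) * u) = ?t powr (\<sigma> - N)"
      by (simp add: powr_def exp_add[symmetric] algebra_simps)
    ultimately show ?thesis
      unfolding W_def mult.assoc[symmetric] by simp
  qed
  have "\<forall>\<^sub>F u in at_top. enn2real I + 1 \<le> exp ((\<sigma> - D) * - u) * W u"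
    using scaled_W_at_top[OF \<sigma>] by (simp add: filterlim_at_top)
  moreover have "\<forall>\<^sub>F u in at_top. u0 \<le> u" by (rule eventually_ge_at_top)
  ultimately have "\<forall>\<^sub>F u :: real in at_top. False"
    by eventually_elim (use le in force)
  thus False by simp
qed

lemma abscissa: "zeta_abscissa \<delta> A = D"
proof -
  let ?S = "{\<sigma>. 0 \<le> \<sigma> \<and> (\<integral>\<^sup>+x\<in>tube A \<delta>. dist_power (infdist x A) (\<sigma> - real DIM('a)) \<partial>lebesgue) < \<infinity>}"
  have mem: "\<sigma> \<in> ?S" if "D < \<sigma>" "\<sigma> < N" for \<sigma> using abscissa_member[OF that] that D by simp
  have bdd: "bdd_below ?S" by (rule bdd_belowI[of _ 0]) simp
  have "Inf ?S \<le> D"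
  proof (rule dense_ge_bounded[OF D(2)])
    fix \<sigma> assume "D < \<sigma>" "\<sigma> < N"
    thus "Inf ?S \<le> \<sigma>" by (intro cInf_lower mem bdd)
  qed
  moreover have "D \<le> Inf ?S"
  proof (rule cInf_greatest)
    have "(D + N) / 2 \<in> ?S" using D by (intro mem) auto
    thus "?S \<noteq> {}" by blast
  qed (use abscissa_lower in blast)
  ultimately show ?thesis unfolding zeta_abscissa_def by simp
qed

section \<open>The continuation as a quotient and its poles\<close>

definition den :: "complex \<Rightarrow> complex" where
  "den s = 1 - exp (- of_real T * (s - of_real D))"

text \<open>This is \<open>den s\<close> times the formula for the zeta function, with the Laplace
  transform of \<open>G\<close>, defined only to the right of \<open>D\<close>, already replaced by
  \<open>period_integral\<close> over \<open>den\<close>. All ingredients are holomorphic for Re s >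
  D - \<alpha>.\<close>

definition num :: "complex \<Rightarrow> complex" where
  "num s = den s * (of_real \<delta> powr (s - of_real N) * of_real (tube_volume A \<delta>) +
      (of_real N - s) * laplace_rho (s - of_real D)) + (of_real N - s) * period_integral (s - of_real D)"

definition ext :: "complex \<Rightarrow> complex" where
  "ext = remove_sings (\<lambda>s. num s / den s)"

text \<open>The zeros of \<open>den\<close>, hence candidates only: a candidate is a true pole when
  its Fourier coefficient is nonzero.\<close>

definition pole :: "int \<Rightarrow> complex" where
  "pole k = of_real D + of_real (2 * pi / T) * \<i> * of_int k"

abbreviation "H \<equiv> half_plane (D - \<alpha>)"

lemma half_plane_props: "open (half_plane c)" "connected (half_plane c)"
  unfolding half_plane_def
  by (auto intro: open_halfspace_Re_gt convex_connected convex_halfspace_Re_gt)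

lemma den_holomorphic: "den holomorphic_on H"
  unfolding den_def by (intro holomorphic_intros)

lemma num_holomorphic: "num holomorphic_on H"
proof -
  have "(\<lambda>s. laplace_rho (s - of_real D)) holomorphic_on H"
    by (rule holomorphic_on_compose_gen[OF _ laplace_rho_holomorphic, unfolded o_def])
       (auto intro!: holomorphic_intros simp: half_plane_def)
  moreover have "(\<lambda>s. period_integral (s - of_real D)) holomorphic_on H"
    by (rule holomorphic_on_compose_gen[OF _ period_integral_holomorphic, unfolded o_def])
       (auto intro!: holomorphic_intros)
  ultimately show ?thesis
    unfolding num_def using den_holomorphic \<delta> by (intro holomorphic_intros) auto
qed

lemma den_zero_iff: "den s = 0 \<longleftrightarrow> (\<exists>k. s = pole k)"
proof
  assume "den s = 0"
  hence "exp (- of_real T * (s - of_real D)) = 1" by (simp add: den_def)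
  then obtain n :: int where "Re (- of_real T * (s - of_real D)) = 0" "Im (- of_real T * (s - of_real D)) = of_int (2 * n) * pi"
    unfolding exp_eq_1 by blast
  hence "Re s = D" "Im s = 2 * pi / T * of_int (- n)" using T by (auto simp: field_simps)
  hence "s = pole (- n)" by (simp add: complex_eq_iff pole_def)
  thus "\<exists>k. s = pole k" ..
next
  assume "\<exists>k. s = pole k"
  then obtain k where s: "s = pole k" ..
  have "- of_real T * (s - of_real D) = \<i> * (of_int (- k) * (complex_of_real pi * 2))"
    using T by (simp add: s pole_def)
  hence "exp (- of_real T * (s - of_real D)) = exp (0 + \<i> * (of_int (- k) * (complex_of_real pi * 2)))" by simp
  also have "\<dots> = 1" by (simp only: exp_plus_2pin exp_zero)
  finally show "den s = 0" by (simp add: den_def)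
qed

lemma den_deriv: "(den has_field_derivative of_real T) (at (pole k))"
proof -
  have "exp (- of_real T * (pole k - of_real D)) = 1"
    using den_zero_iff[of "pole k"] by (auto simp: den_def)
  thus ?thesis unfolding den_def[abs_def]
    by (auto intro!: derivative_eq_intros)
qed

lemma Re_pole: "Re (pole k) = D"
  by (simp add: pole_def)

lemma pole_in_H: "pole k \<in> H"
  using \<alpha> by (simp add: half_plane_def Re_pole)

text \<open>The terms multiplied by \<open>den\<close> vanish here, so neither the boundary term nor
  the error \<open>rho\<close> influences the residue.\<close>

lemma num_pole: "num (pole k) = (of_real N - pole k) * truncated_fourier G T (of_int k / T)"
proof -
  have "den (pole k) = 0" using den_zero_iff by blast
  moreover have "period_integral (pole k - of_real D) = truncated_fourier G T (of_int k / T)"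
    using laplace_period_eq_truncated_fourier[OF continuous_G per T, of u0 k]
    by (simp add: period_integral_def pole_def)
  ultimately show ?thesis by (simp add: num_def)
qed

text \<open>The factor \<open>N - pole k\<close> has real part \<open>N - D > 0\<close> and so
  cannot cancel a pole.\<close>

lemma num_pole_eq_0_iff: "num (pole k) = 0 \<longleftrightarrow> truncated_fourier G T (of_int k / T) = 0"
proof -
  have "Re (of_real N - pole k) \<noteq> 0" using D by (simp add: Re_pole)
  hence "of_real N - pole k \<noteq> 0" by (metis zero_complex.sel(1))
  thus ?thesis by (simp add: num_pole)
qed

lemma zeta_eq_ext:
  assumes s: "D < Re s"
  shows "ext s = distance_zeta \<delta> A s"
proof -
  have ne: "den s \<noteq> 0" using den_zero_iff[of s] Re_pole s by force
  have sH: "s \<in> H" using s \<alpha> by (simp add: half_plane_def)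
  have "num s = distance_zeta \<delta> A s * den s"
  proof -
    \<comment> \<open>Here \<open>L\<close> is the Laplace transform of \<open>W\<close>,
      \<open>d\<close> the denominator, \<open>p\<close> the period integral, \<open>r\<close> the
      transform of \<open>rho\<close>, \<open>c\<close> the boundary term and \<open>m\<close> the
      factor \<open>N - s\<close>.\<close>
    have alg: "L * d = p + d * r \<Longrightarrow> d * (c + m * r) + m * p = (c + m * L) * d" for L d p r c m :: complex
      by algebra
    have "0 < Re (s - of_real D)" using s by simp
    from laplace_W(2)[OF this] show ?thesis
      unfolding zeta_formula(2)[OF s] num_def den_def by (rule alg)
  qed
  moreover have "ext s = num s / den s"
    unfolding ext_def using quotient_at_nonzero(1)[OF half_plane_props num_holomorphic den_holomorphic sH ne] .
  ultimately show ?thesis using ne by simp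
qed

lemmas at_pole = half_plane_props num_holomorphic den_holomorphic pole_in_H den_deriv

lemma den_pole: "den (pole k) = 0"
  using den_zero_iff by blast

lemma ext_nicely_meromorphic: "ext nicely_meromorphic_on H"
  unfolding ext_def
  by (rule remove_sings_nicely_meromorphic[OF quotient_meromorphic[OF at_pole den_pole]]) (use T in auto)

lemma ext_is_pole_iff:
  assumes "s \<in> H"
  shows "is_pole ext s \<longleftrightarrow> (\<exists>k. s = pole k \<and> truncated_fourier G T (of_int k / T) \<noteq> 0)"
proof (cases "\<exists>k. s = pole k")
  case True
  then obtain k where k: "s = pole k" ..
  have "inj pole" using T by (auto intro!: injI simp: pole_def)
  hence "(\<exists>k'. s = pole k' \<and> truncated_fourier G T (of_int k' / T) \<noteq> 0) \<longleftrightarrow> truncated_fourier G T (of_int k / T) \<noteq> 0"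
    using k by (auto dest: injD)
  moreover have "is_pole ext s \<longleftrightarrow> num s \<noteq> 0"
    unfolding ext_def k by (rule quotient_pole_iff[OF at_pole den_pole]) (use T in auto)
  ultimately show ?thesis using num_pole_eq_0_iff k by simp
next
  case False
  hence "den s \<noteq> 0" by (simp add: den_zero_iff)
  hence "\<not> is_pole ext s"
    unfolding ext_def by (rule quotient_at_nonzero(2)[OF half_plane_props num_holomorphic den_holomorphic assms])
  thus ?thesis using False by blast
qed

lemma ext_zorder: "truncated_fourier G T (of_int k / T) \<noteq> 0 \<Longrightarrow> zorder ext (pole k) = -1"
  unfolding ext_def by (rule quotient_zorder[OF at_pole den_pole]) (use T num_pole_eq_0_iff in auto)

lemma ext_residue: "residue ext (pole k) = (of_real N - pole k) / of_real T * truncated_fourier G T (of_int k / T)"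
  unfolding ext_def by (subst quotient_residue[OF at_pole den_pole]) (use T in \<open>auto simp: num_pole\<close>)

lemma ext_continuation:
  "meromorphic_continuation (distance_zeta \<delta> A) (half_plane (zeta_abscissa \<delta> A)) ext H"
  unfolding meromorphic_continuation_def abscissa
  using half_plane_props ext_nicely_meromorphic zeta_eq_ext by (auto simp: half_plane_def)

lemma continuation_unique:
  assumes F: "meromorphic_continuation (distance_zeta \<delta> A) (half_plane (zeta_abscissa \<delta> A)) F H" and s: "s \<in> H"
  shows "F s = ext s"
proof (rule nicely_meromorphic_on_eq(1)[OF _ ext_nicely_meromorphic half_plane_props _ _ _ _ s])
  show "F nicely_meromorphic_on H" using F by (simp add: meromorphic_continuation_def)
  show "open (half_plane D)" by (rule half_plane_props)
  show "half_plane D \<noteq> {}"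
  proof -
    have "of_real (D + 1) \<in> half_plane D" by (simp add: half_plane_def)
    thus ?thesis by blast
  qed
  show sub: "half_plane D \<subseteq> H" using \<alpha> by (auto simp: half_plane_def)
  show "F z = ext z" if "z \<in> half_plane D" for z
    using F that sub zeta_eq_ext[of z] by (auto simp: meromorphic_continuation_def abscissa half_plane_def)
qed

lemma meromorphic_abscissa_le:
  "meromorphic_abscissa (distance_zeta \<delta> A) (half_plane (zeta_abscissa \<delta> A)) \<le> ereal (D - \<alpha>)"
  unfolding meromorphic_abscissa_def using ext_continuation by (intro Inf_lower) blast

lemma poles_eq: "poles_in ext H = {pole k | k. truncated_fourier G T (of_int k / T) \<noteq> 0}"
  unfolding poles_in_def using ext_is_pole_iff pole_in_H by auto

text \<open>A competing continuation is compared with \<open>ext\<close> on a ball around a point of the critical line,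
  half of which lies in the half-plane where both equal the zeta function.\<close>

lemma principal_complex_dims_eq: "principal_complex_dims \<delta> A = poles_in ext H"
proof (intro equalityI subsetI)
  fix w assume "w \<in> poles_in ext H"
  then obtain k where k: "w = pole k" and w: "is_pole ext w" "w \<in> H"
    unfolding poles_in_def using ext_is_pole_iff by blast
  have "{s. D \<le> Re s} \<subseteq> H" using \<alpha> by (auto simp: half_plane_def)
  thus "w \<in> principal_complex_dims \<delta> A"
    unfolding principal_complex_dims_def
    using k w Re_pole ext_continuation by (auto simp: abscissa)
next
  fix w assume "w \<in> principal_complex_dims \<delta> A"
  then obtain U F where w: "Re w = D" and U: "{s. D \<le> Re s} \<subseteq> U"
    and F: "meromorphic_continuation (distance_zeta \<delta> A) (half_plane D) F U" "is_pole F w"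
    unfolding principal_complex_dims_def abscissa by blast
  have wH: "w \<in> H" using w \<alpha> by (simp add: half_plane_def)
  have "open (U \<inter> H)" "w \<in> U \<inter> H"
    using F U w wH half_plane_props by (auto simp: meromorphic_continuation_def)
  then obtain r where r: "0 < r" "ball w r \<subseteq> U \<inter> H" by (meson open_contains_ball)
  have "is_pole F w \<longleftrightarrow> is_pole ext w"
  proof (rule nicely_meromorphic_on_eq(2)[where A = "ball w r" and B = "ball w r \<inter> half_plane D"])
    show "F nicely_meromorphic_on ball w r"
      using F r by (auto simp: meromorphic_continuation_def intro: nicely_meromorphic_on_subset)
    show "ext nicely_meromorphic_on ball w r"
      using ext_nicely_meromorphic r by (auto intro: nicely_meromorphic_on_subset)
    show "open (ball w r \<inter> half_plane D)" using half_plane_props by auto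
    have "w + of_real (r / 2) \<in> ball w r \<inter> half_plane D"
      using r w by (simp add: half_plane_def dist_norm)
    thus "ball w r \<inter> half_plane D \<noteq> {}" by blast
    show "F z = ext z" if "z \<in> ball w r \<inter> half_plane D" for z
      using F that r zeta_eq_ext[of z] by (auto simp: meromorphic_continuation_def half_plane_def)
  qed (use r in auto)
  thus "w \<in> poles_in ext H" using F wH by (simp add: poles_in_def)
qed

section \<open>Residues, their growth and the bounds at \<open>D\<close>\<close>

lemma truncated_fourier_0: "truncated_fourier G T 0 = of_real (integral {0..T} G)"
proof -
  have "G integrable_on {0..T}"
    by (intro integrable_continuous_interval continuous_on_subset[OF continuous_G]) auto
  from integral_linear[OF this bounded_linear_of_real[where 'a = complex]]
  show ?thesis
    unfolding truncated_fourier_eq_integral[OF continuous_G] by (simp add: o_def)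
qed

lemma LINT_G: "(LINT \<tau>:{0..T}|lebesgue. G \<tau>) = integral {0..T} G"
  by (intro set_lebesgue_integral_eq_integral absolutely_integrable_continuous_real
      continuous_on_subset[OF continuous_G]) auto

lemma integral_G_pos: "0 < integral {0..T} G"
  using periodic_mean_strict[OF continuous_G per T, of 0 0] G0 G_pos[of 0] by simp

lemma pole_0: "pole 0 = of_real D"
  by (simp add: pole_def)

lemma residue_D: "residue ext (of_real D) = of_real ((N - D) * (1 / T * (LINT \<tau>:{0..T}|lebesgue. G \<tau>)))"
  using ext_residue[of 0] by (simp add: pole_0 truncated_fourier_0 LINT_G)

lemma residue_small:
  assumes e: "0 < e"
  shows "\<exists>K::real. \<forall>k::int. K < \<bar>of_int k\<bar> \<longrightarrow> norm (residue ext (pole k)) \<le> e * \<bar>of_int k\<bar>"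
proof -
  \<comment> \<open>Chosen so that |N - pole k| \<le> c T |k| for |k| \<ge> 1; after division by
    \<open>T\<close> a coefficient of size at most \<open>e / c\<close> gives the bound e
    |k|.\<close>
  define c where "c = (N - D + 2 * pi / T) / T"
  have c: "0 < c" using D T by (auto simp: c_def intro!: divide_pos_pos add_pos_pos)
  obtain K where K: "\<And>k::int. K < \<bar>real_of_int k\<bar> \<Longrightarrow> norm (truncated_fourier G T (of_int k / T)) \<le> e / c"
    using truncated_fourier_small[OF continuous_G per T, of "e / c"] e c by auto
  have "norm (residue ext (pole k)) \<le> e * \<bar>of_int k\<bar>" if k: "max K 1 < \<bar>of_int k\<bar>" for k
  proof -
    have "norm (of_real N - pole k) \<le> (N - D) + 2 * pi / T * \<bar>of_int k\<bar>"
    proof -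
      have "of_real N - pole k = of_real (N - D) + - (of_real (2 * pi / T) * \<i> * of_int k)" by (simp add: pole_def)
      also have "norm \<dots> \<le> norm (complex_of_real (N - D)) + norm (- (of_real (2 * pi / T) * \<i> * of_int k))"
        by (rule norm_triangle_ineq)
      also have "\<dots> = (N - D) + 2 * pi / T * \<bar>of_int k\<bar>"
        unfolding norm_minus_cancel norm_mult norm_of_real using D T by simp
      finally show ?thesis .
    qed
    also have "\<dots> \<le> (N - D) * \<bar>of_int k\<bar> + 2 * pi / T * \<bar>of_int k\<bar>"
      using D k mult_left_mono[of 1 "\<bar>real_of_int k\<bar>" "N - D"] by simp
    also have "\<dots> = c * T * \<bar>of_int k\<bar>"
    proof -
      have "c * T = N - D + 2 * pi / T" using T by (simp add: c_def)
      thus ?thesis by (simp only: distrib_right)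
    qed
    finally have "norm (of_real N - pole k) / T \<le> c * \<bar>of_int k\<bar>"
      using T by (simp add: field_simps)
    hence "norm (of_real N - pole k) / T * norm (truncated_fourier G T (of_int k / T)) \<le> c * \<bar>of_int k\<bar> * (e / c)"
      using K[of k] k c by (intro mult_mono) auto
    moreover have "norm (residue ext (pole k)) = norm (of_real N - pole k) / T * norm (truncated_fourier G T (of_int k / T))"
      unfolding ext_residue norm_mult norm_divide using T by simp
    ultimately show ?thesis using c by (simp add: mult.commute)
  qed
  thus ?thesis by blast
qed

lemma residue_smallo:
  "(\<lambda>k. cmod (residue ext (pole k))) \<in> o[at_top](\<lambda>k. real_of_int \<bar>k\<bar>)"
  "(\<lambda>k. cmod (residue ext (pole k))) \<in> o[at_bot](\<lambda>k. real_of_int \<bar>k\<bar>)"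
proof -
  have top: "\<forall>\<^sub>F k in at_top. K < \<bar>real_of_int k\<bar>" for K
    by (rule eventually_mono[OF eventually_gt_at_top[of "\<lceil>K\<rceil>"]]) linarith
  have bot: "\<forall>\<^sub>F k in at_bot. K < \<bar>real_of_int k\<bar>" for K
    by (rule eventually_mono[OF eventually_le_at_bot[of "- \<lceil>K\<rceil> - 1"]]) linarith
  show "(\<lambda>k. cmod (residue ext (pole k))) \<in> o[at_top](\<lambda>k. real_of_int \<bar>k\<bar>)"
  proof (rule landau_o.smallI)
    fix e :: real assume "0 < e"
    then obtain K where "\<And>k. K < \<bar>real_of_int k\<bar> \<Longrightarrow> norm (residue ext (pole k)) \<le> e * \<bar>of_int k\<bar>"
      using residue_small by blast
    with top[of K] show "\<forall>\<^sub>F k in at_top. norm (cmod (residue ext (pole k))) \<le> e * norm (real_of_int \<bar>k\<bar>)"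
      by (auto elim: eventually_mono)
  qed
  show "(\<lambda>k. cmod (residue ext (pole k))) \<in> o[at_bot](\<lambda>k. real_of_int \<bar>k\<bar>)"
  proof (rule landau_o.smallI)
    fix e :: real assume "0 < e"
    then obtain K where "\<And>k. K < \<bar>real_of_int k\<bar> \<Longrightarrow> norm (residue ext (pole k)) \<le> e * \<bar>of_int k\<bar>"
      using residue_small by blast
    with bot[of K] show "\<forall>\<^sub>F k in at_bot. norm (cmod (residue ext (pole k))) \<le> e * norm (real_of_int \<bar>k\<bar>)"
      by (auto elim: eventually_mono)
  qed
qed

text \<open>The residue at \<open>D\<close> is \<open>N - D\<close> times the mean of
  \<open>G\<close>, and the mean of a nonconstant continuous periodic function lies strictly between
  its extrema.\<close>

lemma residue_D_bounds:
  assumes nc: "G x \<noteq> G y" and a: "\<And>x. G a \<le> G x" and b: "\<And>x. G x \<le> G b"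
  shows "(N - D) * G a < Re (residue ext (of_real D))" "Re (residue ext (of_real D)) < (N - D) * G b"
proof -
  have ab: "G a < G b" using nc a[of x] a[of y] b[of x] b[of y] by linarith
  have "G a * T < integral {0..T} G"
    by (rule periodic_mean_strict[OF continuous_G per T a ab])
  \<comment> \<open>The upper estimate is the lower one for \<open>- G\<close>, whose minimum is
    \<open>- G b\<close> and which exceeds it at \<open>a\<close>.\<close>
  moreover have "- G b * T < integral {0..T} (\<lambda>x. - G x)"
    by (rule periodic_mean_strict[where y = a]) (use continuous_G per T b ab in \<open>auto intro!: continuous_intros\<close>)
  ultimately have mean: "G a < integral {0..T} G / T" "integral {0..T} G / T < G b"
    using T by (simp_all add: field_simps)
  thus "(N - D) * G a < Re (residue ext (of_real D))" "Re (residue ext (of_real D)) < (N - D) * G b"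
    unfolding residue_D LINT_G using D mean[THEN mult_strict_left_mono, of "N - D"] by simp_all
qed

lemma lower_content_attained: "\<exists>a. (\<forall>x. G a \<le> G x) \<and> lower_minkowski_content D A = ereal (G a)"
  using G_attains lower_content by metis

lemma upper_content_attained: "\<exists>b. (\<forall>x. G x \<le> G b) \<and> upper_minkowski_content D A = ereal (G b)"
  using G_attains upper_content by metis

lemma residue_D_real: "residue ext (of_real D) \<in> \<real>"
  unfolding residue_D by simp

lemma residue_D_content_bounds:
  assumes "G x \<noteq> G y"
  shows "ereal (N - D) * lower_minkowski_content D A < ereal (Re (residue ext (of_real D)))"
    "ereal (Re (residue ext (of_real D))) < ereal (N - D) * upper_minkowski_content D A"
proof -
  obtain a b where ab: "\<And>x. G a \<le> G x" "\<And>x. G x \<le> G b" using G_attains by blast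
  show "ereal (N - D) * lower_minkowski_content D A < ereal (Re (residue ext (of_real D)))"
    "ereal (Re (residue ext (of_real D))) < ereal (N - D) * upper_minkowski_content D A"
    using residue_D_bounds[OF assms ab] lower_content[OF ab(1)] upper_content[OF ab(2)] by simp_all
qed

lemma pole_0_mem: "pole 0 \<in> poles_in ext H"
  unfolding poles_eq using integral_G_pos by (auto intro!: exI[of _ 0] simp: truncated_fourier_0)

lemma pole_mem_iff: "pole k \<in> poles_in ext H \<longleftrightarrow> truncated_fourier G T (of_int k / T) \<noteq> 0"
proof -
  have "inj pole" using T by (auto intro!: injI simp: pole_def)
  thus ?thesis unfolding poles_eq by (auto dest: injD)
qed

lemma pole_minus_mem: "pole k \<in> poles_in ext H \<Longrightarrow> pole (- k) \<in> poles_in ext H"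
  unfolding pole_mem_iff using truncated_fourier_cnj[OF continuous_G, of T "of_int k / T"] by simp

lemma zorder_poles: "w \<in> poles_in ext H \<Longrightarrow> zorder ext w = -1"
  unfolding poles_eq using ext_zorder by blast

end

text \<open>The exponential is integrated over a whole number of its periods. In the measurable case
  this leaves k = 0 as the only pole.\<close>

lemma truncated_fourier_const:
  assumes "k \<noteq> 0"
  shows "truncated_fourier (\<lambda>_. M) 1 (of_int k) = 0"
proof -
  define c where "c = - 2 * complex_of_real pi * \<i> * of_int k"
  have c: "c \<noteq> 0" using assms by (simp add: c_def)
  have "((\<lambda>\<tau>. exp (c * of_real \<tau>) * of_real M) has_integral
      (exp (c * of_real 1) / c * of_real M - exp (c * of_real 0) / c * of_real M)) {0..1}"
    using c by (intro fundamental_theorem_of_calculus)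
      (auto intro!: derivative_eq_intros has_vector_derivative_real_field)
  moreover have "exp c = 1"
  proof -
    have "exp c = exp (0 + \<i> * (of_int (- k) * (complex_of_real pi * 2)))"
      by (simp add: c_def mult_ac)
    thus ?thesis by (simp only: exp_plus_2pin exp_zero)
  qed
  ultimately have "((\<lambda>\<tau>. exp (c * of_real \<tau>) * complex_of_real M) has_integral 0) {0..1}"
    by simp
  from integral_unique[OF this] show ?thesis
    by (simp add: truncated_fourier_eq_integral c_def)
qed

theorem theorem4p10:
  fixes A :: "(real ^ 'n) set" and D \<alpha> \<delta> :: real
  defines "N \<equiv> real CARD('n)"
  defines "\<zeta> \<equiv> distance_zeta \<delta> A"
  defines "\<Omega> \<equiv> half_plane (zeta_abscissa \<delta> A)"
  defines "H \<equiv> half_plane (D - \<alpha>)"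
  assumes "A \<noteq> {}" and "bounded A" and "0 \<le> D" and "D < N" and "0 < \<alpha>" and "0 < \<delta>"
  shows
    "(\<forall>M::real. 0 < M \<longrightarrow>
        (\<exists>R. R \<in> O[at_right 0](\<lambda>t. t powr \<alpha>) \<and>
             (\<forall>\<^sub>F t in at_right 0. tube_volume A t = t powr (N - D) * (M + R t))) \<longrightarrow>
        has_minkowski_dim A D \<and>
        minkowski_measurable A \<and>
        has_minkowski_content D A M \<and>
        zeta_abscissa \<delta> A = D \<and>
        meromorphic_abscissa \<zeta> \<Omega> \<le> ereal (D - \<alpha>) \<and>
        (\<exists>F. meromorphic_continuation \<zeta> \<Omega> F H \<and>
             (\<forall>F'. meromorphic_continuation \<zeta> \<Omega> F' H \<longrightarrow> (\<forall>s\<in>H. F' s = F s)) \<and>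
             poles_in F H = {of_real D} \<and>
             zorder F (of_real D) = -1 \<and>
             residue F (of_real D) = of_real ((N - D) * M)))
     \<and>
     (\<forall>(G :: real \<Rightarrow> real) T.
        (\<forall>x. 0 \<le> G x) \<longrightarrow> (\<exists>x y. G x \<noteq> G y) \<longrightarrow> has_minimal_period G T \<longrightarrow>
        (\<exists>R. R \<in> O[at_right 0](\<lambda>t. t powr \<alpha>) \<and>
             (\<forall>\<^sub>F t in at_right 0. tube_volume A t = t powr (N - D) * (G (ln (1 / t)) + R t))) \<longrightarrow>
        has_minkowski_dim A D \<and>
        continuous_on UNIV G \<and>
        minkowski_nondegenerate A \<and>
        (\<exists>a. (\<forall>x. G a \<le> G x) \<and> lower_minkowski_content D A = ereal (G a)) \<and>
        (\<exists>b. (\<forall>x. G x \<le> G b) \<and> upper_minkowski_content D A = ereal (G b)) \<and>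
        \<not> minkowski_measurable A \<and>
        zeta_abscissa \<delta> A = D \<and>
        meromorphic_abscissa \<zeta> \<Omega> \<le> ereal (D - \<alpha>) \<and>
        (\<exists>F. meromorphic_continuation \<zeta> \<Omega> F H \<and>
             (\<forall>F'. meromorphic_continuation \<zeta> \<Omega> F' H \<longrightarrow> (\<forall>s\<in>H. F' s = F s)) \<and>
             (let s = (\<lambda>k::int. of_real D + of_real (2 * pi / T) * \<i> * of_int k);
                  P = poles_in F H
              in P = {s k | k. truncated_fourier G T (of_int k / T) \<noteq> 0} \<and>
                 P = principal_complex_dims \<delta> A \<and>
                 s 0 = of_real D \<and> s 0 \<in> P \<and>
                 (\<forall>k. s k \<in> P \<longrightarrow> s (- k) \<in> P) \<and>
                 (\<forall>\<omega>\<in>P. zorder F \<omega> = -1) \<and>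
                 (\<forall>k. s k \<in> P \<longrightarrow>
                    residue F (s k) = (of_real N - s k) / of_real T * truncated_fourier G T (of_int k / T)) \<and>
                 (\<lambda>k. cmod (residue F (s k))) \<in> o[at_top](\<lambda>k. real_of_int \<bar>k\<bar>) \<and>
                 (\<lambda>k. cmod (residue F (s k))) \<in> o[at_bot](\<lambda>k. real_of_int \<bar>k\<bar>) \<and>
                 residue F (of_real D) = of_real ((N - D) * (1 / T * (LINT \<tau>:{0..T}|lebesgue. G \<tau>))) \<and>
                 residue F (of_real D) \<in> \<real> \<and>
                 ereal (N - D) * lower_minkowski_content D A < ereal (Re (residue F (of_real D))) \<and>
                 ereal (Re (residue F (of_real D))) < ereal (N - D) * upper_minkowski_content D A)))"
proof (rule conjI, goal_cases)
  case 1
  have N: "N = real DIM((real, 'n) vec)" by (simp add: N_def)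
  show ?case
  proof (intro allI impI, goal_cases)
    case (1 M)
    \<comment> \<open>Every positive number is a period of a constant; with period 1 the frequencies
      \<open>k / T\<close> are the integers themselves.\<close>
    interpret L: periodic_tube_asymptotics A D \<alpha> \<delta> 1 "\<lambda>_. M" N
      by unfold_locales (use assms(5-) N 1 in auto)
    have "has_minkowski_content D A M"
      unfolding has_minkowski_content_def using L.lower_content L.upper_content by auto
    moreover have "minkowski_measurable A" using L.minkowski_measurable_iff by simp
    moreover have poles: "poles_in L.ext H = {of_real D}"
    proof -
      have "k = 0" if "L.pole k \<in> poles_in L.ext H" for k
        using that truncated_fourier_const[of k M] unfolding H_def L.pole_mem_iff by auto
      hence "poles_in L.ext H \<subseteq> {L.pole 0}"
        unfolding H_def L.poles_eq by (auto simp: L.pole_mem_iff)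
      thus ?thesis using L.pole_0_mem by (auto simp: L.pole_0 H_def)
    qed
    moreover have "residue L.ext (of_real D) = of_real ((N - D) * M)"
      unfolding L.residue_D L.LINT_G by simp
    moreover have "zorder L.ext (of_real D) = -1"
      using L.zorder_poles poles by (simp add: H_def)
    ultimately show ?case
      unfolding \<zeta>_def \<Omega>_def H_def
      using L.minkowski_dim L.abscissa L.meromorphic_abscissa_le L.ext_continuation L.continuation_unique
      by blast
  qed
next
  case 2
  have N: "N = real DIM((real, 'n) vec)" by (simp add: N_def)
  show ?case
  proof (intro allI impI, goal_cases)
    case (1 G T)
    then obtain x y where xy: "G x \<noteq> G y" by blast
    interpret L: periodic_tube_asymptotics A D \<alpha> \<delta> T G N
    proof
      show "\<exists>x. G x \<noteq> 0" using xy by metis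
    qed (use assms(5-) N 1 in \<open>auto simp: has_minimal_period_def\<close>)
    have nm: "\<not> minkowski_measurable A" using L.minkowski_measurable_iff xy by blast
    show ?case
      \<comment> \<open>Folding \<open>L.pole_def\<close> identifies the family \<open>s\<close> of
        the statement with \<open>L.pole\<close>, after which each conjunct is a fact of the
        locale.\<close>
      unfolding \<zeta>_def \<Omega>_def H_def Let_def L.pole_def[symmetric]
      by (intro conjI exI[of _ L.ext] ballI allI impI L.minkowski_dim L.continuous_G
          L.minkowski_nondegenerate L.lower_content_attained L.upper_content_attained nm
          L.abscissa L.meromorphic_abscissa_le L.ext_continuation L.continuation_unique
          L.poles_eq L.principal_complex_dims_eq[symmetric] L.pole_0 L.pole_0_mem L.pole_minus_mem
          L.zorder_poles L.ext_residue L.residue_smallo L.residue_D L.residue_D_real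
          L.residue_D_content_bounds[OF xy])
  qed
qed

end
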